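(* For every $\epsilon\in(0,1)$, there exists a constant $\delta\in(0,1)$ such that every nonadaptive $2$-sided error $(\delta,\delta+\epsilon)$-tolerant tester of monotonicity (of real-valued arrays of length $n$) has query complexity $\log^{\Omega(\log(1/\epsilon))} n$.
   Context: A real-valued array $A$ of length $n$ is monotone if $A[u]\le A[v]$ for all $u<v$ in $[n]=\{1,\dots,n\}$. The distance of $A$ to monotonicity is the minimum number of entries of $A$ that must be modified to obtain a monotone array. For $\epsilon,\delta\in(0,1)$, a $(\delta,\epsilon+\delta)$-tolerant tester of monotonicity is a randomized algorithm with query access to $A$ (a query $i\in[n]$ returns $A[i]$) that distinguishes, with probability at least $2/3$, between the case that the distance of $A$ to monotonicity is less than $\delta n$ and the case that it is at least $(\epsilon+\delta)n$; it has 2-sided error if it is allowed to err in both cases. It is nonadaptive if its queries do not depend on the answers to its previous queries. The bound is asymptotic in $n$, and the $\Omega(\cdot)$ in the exponent hides an absolute constant. *)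

theory Defs
  imports "HOL-Probability.Probability"
begin

text \<open>
  A real array of length \<open>n\<close> is a function on \<open>{1..n}\<close>; its values outside \<open>{1..n}\<close> are junk and
  are ignored by every notion below.
\<close>

definition dist_to_mono :: "nat \<Rightarrow> (nat \<Rightarrow> real) \<Rightarrow> nat" where
  "dist_to_mono n A = Inf {card {i \<in> {1..n}. A i \<noteq> B i} | B. mono_on {1..n} B}"

text \<open>
  A deterministic nonadaptive algorithm fixes all its queries in advance, and then decides from the
  list of answers.
\<close>

datatype nonadaptive_alg =
  Nonadaptive (queries: "nat list") (decide: "real list \<Rightarrow> bool")

definition accepts :: "nonadaptive_alg \<Rightarrow> (nat \<Rightarrow> real) \<Rightarrow> bool" where
  "accepts D A \<longleftrightarrow> decide D (map A (queries D))"

text \<open>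
  A randomized nonadaptive algorithm is a probability measure on deterministic ones. There is no
  loss of generality in this choice of sample space: an algorithm that uses a random seed from an
  arbitrary probability space is represented by the image measure, on the range of the map
  from seeds to deterministic algorithms, with the largest \<open>\<sigma>\<close>-algebra that makes this map measurable.
  The \<open>\<sigma>\<close>-algebra of \<open>T\<close> is only required to give every input array an
  acceptance probability.
\<close>

definition nonadaptive_randomized_alg :: "nat \<Rightarrow> nonadaptive_alg measure \<Rightarrow> bool" where
  "nonadaptive_randomized_alg n T \<longleftrightarrow>
     prob_space T \<and>
     (\<forall>D \<in> space T. set (queries D) \<subseteq> {1..n}) \<and>
     (\<forall>A. {D \<in> space T. accepts D A} \<in> sets T)"

text \<open>
  Worst case over the randomness; infinite if the number of queries is unbounded.
\<close>

definition query_complexity :: "nonadaptive_alg measure \<Rightarrow> ereal" where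
  "query_complexity T = (SUP D \<in> space T. ereal (real (length (queries D))))"

definition nonadaptive_tolerant_tester ::
    "nat \<Rightarrow> real \<Rightarrow> real \<Rightarrow> nonadaptive_alg measure \<Rightarrow> bool" where
  "nonadaptive_tolerant_tester n \<epsilon>1 \<epsilon>2 T \<longleftrightarrow>
     nonadaptive_randomized_alg n T \<and>
     (\<forall>A. real (dist_to_mono n A) < \<epsilon>1 * real n \<longrightarrow>
        measure T {D \<in> space T. accepts D A} \<ge> 2 / 3) \<and>
     (\<forall>A. real (dist_to_mono n A) \<ge> \<epsilon>2 * real n \<longrightarrow>
        measure T {D \<in> space T. \<not> accepts D A} \<ge> 2 / 3)"

end

theory Submission
  imports Defs "HOL-Real_Asymp.Real_Asymp"
begin

text \<open>
  Write positions in base \<open>B = 4 b\<close> and choose random levels \<open>i\<^sub>1 > \<dots> > i\<^sub>t > k\<close>. Every node of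
  level \<open>i\<^sub>j\<close> carries a secret bit \<open>s\<close>; its children fall into four groups, whose secrets
  \<open>r\<close>, \<open>r + s\<close>, \<open>1 + r\<close>, \<open>1 + r + s\<close> (mod 2) share \<open>s\<close> by means of a random bit \<open>r\<close> of the node.
  The array exchanges the first group with the second and the third with the fourth, so that an
  increasing sequence uses only one group of each pair; at level \<open>k\<close> the \<open>B\<close> children are in
  increasing order if the secret is 1 and in decreasing order if it is 0. If all secrets of level
  \<open>i\<^sub>1\<close> are 1, the longest increasing subsequence has density \<open>2\<^sup>-\<^sup>t\<close>, and if they are all 0, it has
  density \<open>2\<^sup>-\<^sup>t - (1 - 1 / B) 4\<^sup>-\<^sup>t\<close>, whatever the random bits are.

  A set of queries can tell these cases apart only if it contains a full binary tree that branches
  exactly at the chosen levels: otherwise, a change of the random bits flips the secret at the top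
  without a visible effect, once a random offset at each node of level \<open>k\<close> hides the position of
  a single child. By induction on \<open>t\<close>, where a query is charged whenever it lies in the smaller half of
  a node, \<open>q\<close> queries contain such trees for at most \<open>q (log q)\<^sup>t\<^sup>+\<^sup>1\<close> choices of the levels, out of
  \<open>\<Omega>(log n)\<^sup>t\<^sup>+\<^sup>1\<close> choices.
\<close>

subsection \<open>Secret sharing along the digits\<close>

locale quaternary_base =
  fixes b :: nat
  assumes b_pos: "b > 0"
begin

definition B :: nat where "B = 4 * b"

text \<open>Positions are the leaves of a \<open>B\<close>-ary tree: \<open>node i x\<close> is the
  ancestor of \<open>x\<close> at height \<open>i\<close>, a block of \<open>B ^ i\<close>
  consecutive positions, and \<open>dig i x\<close> tells which child of
  \<open>node (Suc i) x\<close> contains \<open>x\<close>.\<close>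

definition node :: "nat \<Rightarrow> nat \<Rightarrow> nat" where
  "node i x = x div B ^ i"

definition dig :: "nat \<Rightarrow> nat \<Rightarrow> nat" where
  "dig i x = node i x mod B"

definition grp :: "nat \<Rightarrow> nat \<Rightarrow> nat" where
  "grp i x = dig i x div b"

text \<open>The random bit of a node is stored as membership in \<open>\<rho>\<close> of the pair of
  a level and the index of the node. The even groups alone, or the odd groups alone, are compatible
  with both values of \<open>s\<close>, because the bit can be changed too.\<close>

definition child :: "(nat \<times> nat) set \<Rightarrow> bool \<Rightarrow> nat \<Rightarrow> nat \<Rightarrow> bool" where
  "child \<rho> s i x \<longleftrightarrow>
     (((i, node (Suc i) x) \<in> \<rho>) \<noteq> (s \<and> odd (grp i x))) \<noteq> (2 \<le> grp i x)"

text \<open>Levels absent from the list pass the secret on unchanged, so the recursion visits the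
  chosen levels only, from the top down.\<close>

fun label :: "(nat \<times> nat) set \<Rightarrow> bool \<Rightarrow> nat list \<Rightarrow> nat \<Rightarrow> bool" where
  "label \<rho> s [] x = s"
| "label \<rho> s (i # is) x = label \<rho> (child \<rho> s i x) is x"

definition branches :: "nat set \<Rightarrow> nat \<Rightarrow> nat \<Rightarrow> bool" where
  "branches Q k x \<longleftrightarrow> (\<exists>y\<in>Q. node (Suc k) y = node (Suc k) x \<and> node k y \<noteq> node k x)"

definition half :: "nat set \<Rightarrow> nat \<Rightarrow> nat \<Rightarrow> bool \<Rightarrow> nat set" where
  "half Q i p c = {x \<in> Q. node (Suc i) x = p \<and> odd (grp i x) = c}"

text \<open>The full binary trees of the overview. The two subtrees may use different nodes, but
  they branch at the same levels; at level \<open>k\<close> two children must be queried, since a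
  single child does not show the order of the children.\<close>

fun seen :: "nat set \<Rightarrow> nat list \<Rightarrow> nat \<Rightarrow> bool" where
  "seen Q [] k \<longleftrightarrow> (\<exists>x\<in>Q. branches Q k x)"
| "seen Q (i # is) k \<longleftrightarrow> (\<exists>p. seen (half Q i p True) is k \<and> seen (half Q i p False) is k)"

lemma B_pos: "B > 0" and B_gt_1: "B > 1"
  using b_pos by (auto simp: B_def)

lemma dig_less: "dig i x < B"
  using B_pos by (simp add: dig_def)

lemma grp_less: "grp i x < 4"
  using dig_less[of i x] b_pos by (simp add: grp_def B_def less_mult_imp_div_less mult.commute)

lemma node_0: "node 0 x = x"
  by (simp add: node_def)

lemma node_Suc: "node (Suc i) x = node i x div B"
  by (metis node_def power_Suc2 div_mult2_eq)

lemma node_eq_div: "i \<le> j \<Longrightarrow> node j x = node i x div B ^ (j - i)"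
  by (metis node_def le_add_diff_inverse power_add div_mult2_eq)

lemma node_eq_mono: "node i x = node i y \<Longrightarrow> i \<le> j \<Longrightarrow> node j x = node j y"
  by (simp add: node_eq_div)

lemma node_dig: "node i x = node (Suc i) x * B + dig i x"
  by (simp add: node_Suc dig_def)

lemma child_cong: "node i x = node i y \<Longrightarrow> child \<rho> s i x = child \<rho> s i y"
  by (simp add: child_def node_Suc grp_def dig_def)

lemma label_cong:
  assumes "\<And>i. i \<in> set is \<Longrightarrow> node i x = node i y"
  shows "label \<rho> s is x = label \<rho> s is y"
  using assms by (induction "is" arbitrary: s) (simp_all add: child_cong[of _ x y])

lemma label_cong_shares:
  assumes "\<And>i. i \<in> set is \<Longrightarrow> (i, node (Suc i) x) \<in> \<rho> \<longleftrightarrow> (i, node (Suc i) x) \<in> \<rho>'"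
  shows "label \<rho> s is x = label \<rho>' s is x"
  using assms by (induction "is" arbitrary: s) (simp_all add: child_def)

lemma branches_mono: "branches Q k x \<Longrightarrow> Q \<subseteq> Q' \<Longrightarrow> branches Q' k x"
  by (auto simp: branches_def)

lemma half_mono: "Q \<subseteq> Q' \<Longrightarrow> half Q i p c \<subseteq> half Q' i p c"
  by (auto simp: half_def)

lemma seen_mono: "seen Q is k \<Longrightarrow> Q \<subseteq> Q' \<Longrightarrow> seen Q' is k"
proof (induction "is" arbitrary: Q Q')
  case Nil
  then show ?case using branches_mono by (simp, blast)
next
  case (Cons i "is")
  then show ?case using half_mono by (metis seen.simps(2))
qed

text \<open>The topmost branching node has height at most \<open>l\<close>, so the whole tree lies
  below one node of height \<open>l\<close>.\<close>

lemma seen_within_node: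
  assumes "seen Q is k" "k < l" "\<And>j. j \<in> set is \<Longrightarrow> j < l"
  shows "\<exists>p. seen {x \<in> Q. node l x = p} is k"
proof (cases "is")
  case Nil
  with assms(1) obtain x y where xy: "x \<in> Q" "y \<in> Q" "node (Suc k) y = node (Suc k) x"
    "node k y \<noteq> node k x" by (auto simp: branches_def)
  have "node l y = node l x" by (rule node_eq_mono[OF xy(3)]) (use assms(2) in simp)
  with xy have "branches {z \<in> Q. node l z = node l x} k x"
    by (auto simp: branches_def)
  with Nil xy(1) show ?thesis by auto
next
  case (Cons i js)
  with assms(1) obtain p where
    p: "seen (half Q i p True) js k" "seen (half Q i p False) js k" by auto
  have il: "Suc i \<le> l" using assms(3) Cons by (simp add: Suc_leI)
  have "half {x \<in> Q. node l x = p div B ^ (l - Suc i)} i p c = half Q i p c" for c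
    by (auto simp: half_def node_eq_div[OF il])
  with p Cons show ?thesis by (simp only: seen.simps) metis
qed

text \<open>
  The change of the secret is pushed down, at every node, into the half of the node in which
  the queries cannot recognise it.
\<close>

lemma flip_shares:
  assumes "\<not> seen Q is k" "sorted_wrt (>) (is @ [k])"
  shows "\<exists>F \<subseteq> (\<lambda>(i, x). (i, node (Suc i) x)) ` (set is \<times> Q).
     \<forall>\<rho> s. \<forall>x\<in>Q. branches Q k x \<longrightarrow> label (sym_diff \<rho> F) (\<not> s) is x = label \<rho> s is x"
  using assms
proof (induction "is" arbitrary: Q)
  case Nil
  then show ?case by auto
next
  case (Cons i "is")
  \<comment> \<open>At a node of \<open>P\<close> the odd half shows a tree for the lower levels, so
    the even half does not. \<open>H\<close> takes from every node a half without such a tree; the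
    change of the secret is directed there.\<close>
  define P where "P = {p. seen (half Q i p True) is k}"
  define H where "H = {x \<in> Q. odd (grp i x) \<noteq> (node (Suc i) x \<in> P)}"
  have ki: "k < i" and isi: "\<And>j. j \<in> set is \<Longrightarrow> j < i" using Cons.prems(2) by auto
  \<comment> \<open>Among the queries, \<open>H\<close> consists of whole nodes of height
    \<open>i\<close>. Hence the shares in \<open>F\<close>, which belong to lower nodes met by
    \<open>H\<close>, have no influence on a query outside \<open>H\<close>.\<close>
  have H_closed: "x \<in> H" if "y \<in> H" "x \<in> Q" "node (Suc j) x = node (Suc j) y" "j < i" for x y j
  proof -
    have "node i x = node i y"
      by (rule node_eq_mono[OF that(3)]) (use that(4) in simp)
    then show ?thesis using that by (simp add: H_def node_Suc grp_def dig_def)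
  qed
  have "\<not> seen H is k"
  proof
    assume "seen H is k"
    from seen_within_node[OF this ki isi] obtain p' where
      p': "seen {x \<in> H. node i x = p'} is k" by auto
    define p where "p = p' div B"
    have "{x \<in> H. node i x = p'} \<subseteq> half Q i p (p \<notin> P)"
      by (auto simp: H_def half_def p_def node_Suc)
    with p' have "seen (half Q i p (p \<notin> P)) is k" by (rule seen_mono)
    with Cons.prems(1) show False by (cases "p \<in> P") (auto simp: P_def)
  qed
  from Cons.IH[OF this] Cons.prems(2) obtain F where
    F: "F \<subseteq> (\<lambda>(i, x). (i, node (Suc i) x)) ` (set is \<times> H)"
    and lab: "\<And>\<rho> s x. x \<in> H \<Longrightarrow> branches H k x \<Longrightarrow>
       label (sym_diff \<rho> F) (\<not> s) is x = label \<rho> s is x" by auto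
  \<comment> \<open>Flipping \<open>s\<close> alone affects the odd groups only; flipping
    \<open>s\<close> together with the share affects the even groups only. With the share flipped
    exactly at the nodes of \<open>P\<close>, the change reaches the queries of \<open>H\<close> and
    no others, and \<open>F\<close> absorbs it there.\<close>
  define G where "G = {i} \<times> (P \<inter> node (Suc i) ` Q) \<union> F"
  have Fi: "(i, q) \<notin> F" for q
  proof
    assume "(i, q) \<in> F"
    with F have "i \<in> set is" by auto
    from isi[OF this] show False by simp
  qed
  have low: "(j, q) \<in> G \<longleftrightarrow> (j, q) \<in> F" if "j \<in> set is" for j q
    using that isi by (auto simp: G_def)
  have "label (sym_diff \<rho> G) (\<not> s) (i # is) x = label \<rho> s (i # is) x"
    if x: "x \<in> Q" and br: "branches Q k x" for \<rho> s x
  proof -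
    have share: "(i, node (Suc i) x) \<in> sym_diff \<rho> G \<longleftrightarrow>
        ((i, node (Suc i) x) \<in> \<rho>) \<noteq> (node (Suc i) x \<in> P)"
      using x Fi by (auto simp: G_def)
    have GF: "label (sym_diff \<rho> G) s' is x = label (sym_diff \<rho> F) s' is x" for s'
      by (rule label_cong_shares) (use low in auto)
    show ?thesis
    proof (cases "x \<in> H")
      case True
      have "child (sym_diff \<rho> G) (\<not> s) i x = (\<not> child \<rho> s i x)"
        using True unfolding child_def share by (auto simp: H_def)
      moreover have "branches H k x"
        using br H_closed[OF True _ _ ki] by (auto simp: branches_def)
      ultimately show ?thesis using lab[OF True] GF by simp
    next
      case False
      have "child (sym_diff \<rho> G) (\<not> s) i x = child \<rho> s i x"
        using False x unfolding child_def share by (auto simp: H_def)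
      moreover have "label (sym_diff \<rho> F) s' is x = label \<rho> s' is x" for s'
      proof (rule label_cong_shares)
        fix j assume j: "j \<in> set is"
        have "(j, node (Suc j) x) \<notin> F"
        proof
          assume "(j, node (Suc j) x) \<in> F"
          with F obtain y where "y \<in> H" "node (Suc j) x = node (Suc j) y" by auto
          from H_closed[OF this(1) x this(2) isi[OF j]] False show False by simp
        qed
        then show "(j, node (Suc j) x) \<in> sym_diff \<rho> F \<longleftrightarrow> (j, node (Suc j) x) \<in> \<rho>" by auto
      qed
      ultimately show ?thesis using GF by simp
    qed
  qed
  moreover have "G \<subseteq> (\<lambda>(i, x). (i, node (Suc i) x)) ` (set (i # is) \<times> Q)"
    using F by (auto simp: G_def H_def)
  ultimately show ?case by blast
qed

subsection \<open>The number of recognised choices of levels\<close>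

text \<open>Each level has its own window of length \<open>m\<close>, and the lowest window
  \<open>{..<m}\<close> is left for \<open>k\<close>. The lists are thereby decreasing, and the
  number of choices is a plain power of \<open>m\<close>.\<close>

primrec upper_levels :: "nat \<Rightarrow> nat \<Rightarrow> nat list set" where
  "upper_levels m 0 = {[]}"
| "upper_levels m (Suc t) = (\<lambda>(i, is). i # is) ` ({Suc t * m..<Suc (Suc t) * m} \<times> upper_levels m t)"

lemma finite_upper_levels: "finite (upper_levels m t)"
  by (induction t) auto

lemma card_upper_levels: "card (upper_levels m t) = m ^ t"
proof (induction t)
  case (Suc t)
  have "card (upper_levels m (Suc t)) = card ({Suc t * m..<Suc (Suc t) * m} \<times> upper_levels m t)"
    unfolding upper_levels.simps by (rule card_image) (auto simp: inj_on_def)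
  then show ?case using Suc by (simp add: card_cartesian_product)
qed simp

lemma upper_levels_bounds:
  "is \<in> upper_levels m t \<Longrightarrow> i \<in> set is \<Longrightarrow> m \<le> i \<and> i < Suc t * m"
proof (induction t arbitrary: "is")
  case (Suc t)
  then obtain j js where j: "is = j # js" "Suc t * m \<le> j" "j < Suc (Suc t) * m" "js \<in> upper_levels m t"
    by auto
  have "i = j \<or> m \<le> i \<and> i < Suc t * m" using Suc.IH[OF j(4)] Suc.prems(2) j(1) by auto
  moreover have "m \<le> Suc t * m" "Suc t * m \<le> Suc (Suc t) * m" by simp_all
  ultimately show ?case using j(2,3) by linarith
qed simp

lemma sorted_upper_levels: "is \<in> upper_levels m t \<Longrightarrow> sorted_wrt (>) is"
proof (induction t arbitrary: "is")
  case (Suc t)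
  then obtain j js where j: "is = j # js" "Suc t * m \<le> j" "js \<in> upper_levels m t" by auto
  have "i < j" if "i \<in> set js" for i using upper_levels_bounds[OF j(3) that] j(2) by linarith
  with Suc.IH[OF j(3)] j(1) show ?case by simp
qed simp

lemma length_upper_levels: "is \<in> upper_levels m t \<Longrightarrow> length is = t"
  by (induction t arbitrary: "is") auto

text \<open>The light edges of a heavy-light decomposition, with the number of queries as the weight
  of a node.\<close>

definition light :: "nat set \<Rightarrow> nat \<Rightarrow> nat set" where
  "light Q x = {i. 2 * card {y \<in> Q. node i y = node i x} \<le> card {y \<in> Q. node (Suc i) y = node (Suc i) x}}"

text \<open>On the way up from \<open>x\<close>, every light level at least doubles the number of
  queries in the current node, and this number never exceeds \<open>card Q\<close>.\<close>

lemma card_light_le: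
  assumes "finite Q" "x \<in> Q" "card Q \<le> 2 ^ l"
  shows "card (light Q x \<inter> {..<n}) \<le> l"
proof -
  have "2 ^ card (light Q x \<inter> {..<n}) \<le> card {y \<in> Q. node n y = node n x}"
  proof (induction n)
    case 0
    have "card {x} \<le> card {y \<in> Q. node 0 y = node 0 x}"
      by (rule card_mono) (use assms in auto)
    then show ?case by simp
  next
    case (Suc n)
    have mono: "card {y \<in> Q. node n y = node n x} \<le> card {y \<in> Q. node (Suc n) y = node (Suc n) x}"
      by (rule card_mono) (use assms in \<open>auto simp: node_Suc\<close>)
    show ?case
    proof (cases "n \<in> light Q x")
      case True
      then have "light Q x \<inter> {..<Suc n} = insert n (light Q x \<inter> {..<n})" by auto
      with True Suc show ?thesis by (auto simp: light_def)
    next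
      case False
      then have "light Q x \<inter> {..<Suc n} = light Q x \<inter> {..<n}" by (auto simp: less_Suc_eq)
      with mono Suc show ?thesis by simp
    qed
  qed
  also have "\<dots> \<le> card Q" by (rule card_mono) (use assms in auto)
  also note assms(3)
  finally show ?thesis by (rule power_le_imp_le_exp[rotated]) simp
qed

text \<open>Of two disjoint children that both hold queries, the one with fewer holds at most half
  of the queries of the node.\<close>

lemma branches_light:
  assumes "finite Q" "x \<in> Q" "branches Q k x"
  shows "\<exists>y\<in>Q. k \<in> light Q y"
proof -
  from assms(3) obtain y where y: "y \<in> Q" "node (Suc k) y = node (Suc k) x" "node k y \<noteq> node k x"
    by (auto simp: branches_def)
  define X Y where "X = {z \<in> Q. node k z = node k x}" and "Y = {z \<in> Q. node k z = node k y}"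
  have "card X + card Y = card (X \<union> Y)"
    by (rule card_Un_disjoint[symmetric]) (use assms y in \<open>auto simp: X_def Y_def\<close>)
  also have "\<dots> \<le> card {z \<in> Q. node (Suc k) z = node (Suc k) x}"
    by (rule card_mono) (use assms y in \<open>auto simp: X_def Y_def node_Suc\<close>)
  finally have "2 * card X \<le> card {z \<in> Q. node (Suc k) z = node (Suc k) x} \<or>
      2 * card Y \<le> card {z \<in> Q. node (Suc k) z = node (Suc k) x}" by linarith
  then have "k \<in> light Q x \<or> k \<in> light Q y" by (auto simp: light_def X_def Y_def y(2))
  with assms(2) y(1) show ?thesis by auto
qed

text \<open>The group is constant on a child, so a child that meets the smaller half lies in it and
  holds at most half of the queries of the node. This allows the smaller half to be charged to light
  levels.\<close>

lemma min_half_le: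
  assumes "finite Q"
  shows "min (card (half Q i p True)) (card (half Q i p False))
           \<le> card {x \<in> Q. node (Suc i) x = p \<and> i \<in> light Q x}"
proof -
  define c where "c = (card (half Q i p True) \<le> card (half Q i p False))"
  have fin: "finite (half Q i p d)" for d using assms by (auto simp: half_def)
  have "2 * card (half Q i p c) \<le> card (half Q i p True) + card (half Q i p False)"
    by (cases c) (auto simp: c_def)
  also have "\<dots> = card (half Q i p True \<union> half Q i p False)"
    by (rule card_Un_disjoint[symmetric]) (use assms in \<open>auto simp: half_def\<close>)
  also have "half Q i p True \<union> half Q i p False = {x \<in> Q. node (Suc i) x = p}"
    by (auto simp: half_def)
  finally have two: "2 * card (half Q i p c) \<le> card {x \<in> Q. node (Suc i) x = p}" .
  have "half Q i p c \<subseteq> {x \<in> Q. node (Suc i) x = p \<and> i \<in> light Q x}"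
  proof
    fix x assume x: "x \<in> half Q i p c"
    have "card {y \<in> Q. node i y = node i x} \<le> card (half Q i p c)"
      by (rule card_mono[OF fin]) (use x in \<open>auto simp: half_def node_Suc grp_def dig_def\<close>)
    with two have "i \<in> light Q x" using x by (auto simp: light_def half_def)
    with x show "x \<in> {x \<in> Q. node (Suc i) x = p \<and> i \<in> light Q x}" by (auto simp: half_def)
  qed
  then have "card (half Q i p c) \<le> card {x \<in> Q. node (Suc i) x = p \<and> i \<in> light Q x}"
    by (rule card_mono[rotated]) (use assms in auto)
  then show ?thesis by (cases c) (auto simp: c_def)
qed

lemma sum_card_light_le:
  assumes "finite Q" "card Q \<le> 2 ^ l"
  shows "(\<Sum>i<n. card {x \<in> Q. i \<in> light Q x}) \<le> card Q * l"
proof -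
  have "(\<Sum>i<n. card {x \<in> Q. i \<in> light Q x}) = (\<Sum>i<n. \<Sum>x\<in>Q. if i \<in> light Q x then 1 else 0)"
    using assms by (simp add: sum.If_cases Collect_conj_eq)
  also have "\<dots> = (\<Sum>x\<in>Q. \<Sum>i<n. if i \<in> light Q x then 1 else 0)" by (rule sum.swap)
  also have "\<dots> = (\<Sum>x\<in>Q. card (light Q x \<inter> {..<n}))"
    by (simp add: sum.If_cases Int_commute)
  also have "\<dots> \<le> (\<Sum>x\<in>Q. l)" by (intro sum_mono card_light_le assms)
  finally show ?thesis by simp
qed

definition seen_levels :: "nat \<Rightarrow> nat set \<Rightarrow> nat \<Rightarrow> (nat list \<times> nat) set" where
  "seen_levels m Q t = {(is, k) \<in> upper_levels m t \<times> {..<m}. seen Q is k}"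

lemma finite_seen_levels: "finite (seen_levels m Q t)"
  by (rule finite_subset[of _ "upper_levels m t \<times> {..<m}"])
     (auto simp: seen_levels_def finite_upper_levels)

lemma not_seen_empty: "\<not> seen {} is k"
proof (induction "is")
  case (Cons i "is")
  have "half {} i p c = {}" for p c by (simp add: half_def)
  with Cons show ?case by simp
qed simp

text \<open>A choice with top level \<open>i\<close> is recognised only if both halves of some node
  recognise the rest, so the induction hypothesis is needed for the smaller half alone. That half is
  charged to the queries that are light at \<open>i\<close>, and a query is light at no more than
  \<open>l\<close> levels: each level costs a factor \<open>l\<close>, while \<open>card Q\<close>
  enters only once.\<close>

lemma card_seen_levels_le:
  assumes "finite Q" "card Q \<le> 2 ^ l"
  shows "card (seen_levels m Q t) \<le> card Q * l ^ Suc t"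
  using assms
proof (induction t arbitrary: Q)
  case 0
  have "seen_levels m Q 0 \<subseteq> Pair [] ` (\<Union>x\<in>Q. light Q x \<inter> {..<m})"
    using branches_light[OF 0(1)] by (fastforce simp: seen_levels_def)
  then have "card (seen_levels m Q 0) \<le> card (Pair ([] :: nat list) ` (\<Union>x\<in>Q. light Q x \<inter> {..<m}))"
    by (rule card_mono[rotated]) (use 0 in auto)
  also have "\<dots> \<le> card (\<Union>x\<in>Q. light Q x \<inter> {..<m})"
    by (rule card_image_le) (use 0 in auto)
  also have "\<dots> \<le> (\<Sum>x\<in>Q. card (light Q x \<inter> {..<m}))" by (rule card_UN_le) (use 0 in auto)
  also have "\<dots> \<le> (\<Sum>x\<in>Q. l)" by (intro sum_mono card_light_le 0)
  finally show ?case by simp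
next
  case (Suc t)
  define N where "N = Suc (Suc t) * m"
  define X where "X i p = seen_levels m (half Q i p True) t \<inter> seen_levels m (half Q i p False) t" for i p
  have fin: "finite (half Q i p c)" "card (half Q i p c) \<le> 2 ^ l" for i p c
  proof -
    show "finite (half Q i p c)" using Suc.prems by (auto simp: half_def)
    have "card (half Q i p c) \<le> card Q" by (rule card_mono) (use Suc.prems in \<open>auto simp: half_def\<close>)
    with Suc.prems show "card (half Q i p c) \<le> 2 ^ l" by simp
  qed
  have X_le: "card (X i p) \<le> card {x \<in> Q. node (Suc i) x = p \<and> i \<in> light Q x} * l ^ Suc t" for i p
  proof -
    have "card (X i p) \<le> card (half Q i p c) * l ^ Suc t" for c
    proof -
      have "card (X i p) \<le> card (seen_levels m (half Q i p c) t)"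
        by (rule card_mono) (cases c; auto simp: X_def finite_seen_levels)+
      also have "\<dots> \<le> card (half Q i p c) * l ^ Suc t" by (rule Suc.IH[OF fin])
      finally show ?thesis .
    qed
    then have "card (X i p) \<le> min (card (half Q i p True)) (card (half Q i p False)) * l ^ Suc t"
      by (simp add: min_def)
    also have "\<dots> \<le> card {x \<in> Q. node (Suc i) x = p \<and> i \<in> light Q x} * l ^ Suc t"
      by (intro mult_right_mono min_half_le Suc.prems) simp
    finally show ?thesis .
  qed
  have "seen_levels m Q (Suc t) \<subseteq>
      (\<Union>i<N. \<Union>p\<in>node (Suc i) ` Q. (\<lambda>(is, k). (i # is, k)) ` X i p)"
  proof (rule subsetI, clarify)
    fix "is" k assume "(is, k) \<in> seen_levels m Q (Suc t)"
    then obtain i js where i: "is = i # js" "i < N" "js \<in> upper_levels m t" "k < m" "seen Q is k"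
      by (auto simp: seen_levels_def N_def)
    then obtain p where p: "seen (half Q i p True) js k" "seen (half Q i p False) js k" by auto
    have "half Q i p True \<noteq> {}" using p not_seen_empty by metis
    then have "p \<in> node (Suc i) ` Q" by (auto simp: half_def)
    moreover have "(js, k) \<in> X i p" using i p by (simp add: X_def seen_levels_def)
    ultimately show "(is, k) \<in> (\<Union>i<N. \<Union>p\<in>node (Suc i) ` Q. (\<lambda>(is, k). (i # is, k)) ` X i p)"
      using i by force
  qed
  then have "card (seen_levels m Q (Suc t)) \<le>
      card (\<Union>i<N. \<Union>p\<in>node (Suc i) ` Q. (\<lambda>(is, k). (i # is, k)) ` X i p)"
    by (rule card_mono[rotated]) (use Suc.prems in \<open>auto simp: X_def finite_seen_levels\<close>)
  also have "\<dots> \<le> (\<Sum>i<N. card (\<Union>p\<in>node (Suc i) ` Q. (\<lambda>(is, k). (i # is, k)) ` X i p))"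
    by (rule card_UN_le) simp
  also have "\<dots> \<le> (\<Sum>i<N. \<Sum>p\<in>node (Suc i) ` Q. card ((\<lambda>(is, k). (i # is, k)) ` X i p))"
    by (intro sum_mono card_UN_le) (use Suc.prems in auto)
  also have "\<dots> \<le> (\<Sum>i<N. \<Sum>p\<in>node (Suc i) ` Q. card (X i p))"
    by (intro sum_mono card_image_le) (simp add: X_def finite_seen_levels)
  also have "\<dots> \<le> (\<Sum>i<N. \<Sum>p\<in>node (Suc i) ` Q.
      card {x \<in> Q. node (Suc i) x = p \<and> i \<in> light Q x} * l ^ Suc t)"
    by (intro sum_mono X_le)
  also have "\<dots> = (\<Sum>i<N. card {x \<in> Q. i \<in> light Q x} * l ^ Suc t)"
  proof (rule sum.cong[OF refl])
    fix i
    have "(\<Sum>p\<in>node (Suc i) ` Q. card {x \<in> Q. node (Suc i) x = p \<and> i \<in> light Q x}) =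
        card (\<Union>p\<in>node (Suc i) ` Q. {x \<in> Q. node (Suc i) x = p \<and> i \<in> light Q x})"
      by (rule card_UN_disjoint[symmetric]) (use Suc.prems in auto)
    also have "(\<Union>p\<in>node (Suc i) ` Q. {x \<in> Q. node (Suc i) x = p \<and> i \<in> light Q x}) =
        {x \<in> Q. i \<in> light Q x}" by auto
    finally show "(\<Sum>p\<in>node (Suc i) ` Q.
        card {x \<in> Q. node (Suc i) x = p \<and> i \<in> light Q x} * l ^ Suc t) =
        card {x \<in> Q. i \<in> light Q x} * l ^ Suc t" by (simp add: sum_distrib_right[symmetric])
  qed
  also have "\<dots> = (\<Sum>i<N. card {x \<in> Q. i \<in> light Q x}) * l ^ Suc t" by (simp add: sum_distrib_right)
  also have "\<dots> \<le> card Q * l * l ^ Suc t"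
    by (intro mult_right_mono sum_card_light_le Suc.prems) simp
  finally show ?case by (simp add: mult_ac)
qed

subsection \<open>The arrays and their distance to monotonicity\<close>

definition swap_group :: "nat \<Rightarrow> nat" where
  "swap_group d = (if even (d div b) then d + b else d - b)"

text \<open>\<open>U\<close> gives the offset of each node of height \<open>Suc k\<close>, and
  \<open>f\<close> the bottom label that decides the order of its children. An offset moves all
  values of the node alike, so it does not affect their order.\<close>

definition out_digit :: "nat list \<Rightarrow> nat \<Rightarrow> (nat \<Rightarrow> bool) \<Rightarrow> (nat \<Rightarrow> int) \<Rightarrow> nat \<Rightarrow> nat \<Rightarrow> int" where
  "out_digit is k f U i x =
     (if i = k then U (node (Suc k) x) + (if f x then int (dig k x) else int (B - 1 - dig k x))
      else if i \<in> set is then int (swap_group (dig i x)) else int (dig i x))"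

text \<open>The number with the digits \<open>e\<close> in base \<open>C\<close>, read from level
  \<open>L - 1\<close> downwards, after \<open>j\<close> digits; the index of the node of height
  \<open>L\<close> is the leading digit.\<close>

primrec assemble :: "(nat \<Rightarrow> nat \<Rightarrow> int) \<Rightarrow> int \<Rightarrow> nat \<Rightarrow> nat \<Rightarrow> nat \<Rightarrow> int" where
  "assemble e C L 0 x = int (node L x)"
| "assemble e C L (Suc j) x = assemble e C L j x * C + e (L - Suc j) x"

lemma assemble_cong:
  assumes "\<And>i. L - j \<le> i \<Longrightarrow> i < L \<Longrightarrow> e i x = e' i y" "node (L - j) x = node (L - j) y" "j \<le> L"
  shows "assemble e C L j x = assemble e' C L j y"
  using assms
proof (induction j)
  case (Suc j)
  have "node (L - j) x = node (L - j) y"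
    by (rule node_eq_mono[OF Suc.prems(2)]) simp
  with Suc show ?case by simp
qed simp

text \<open>Lexicographic comparison: when the digits lie between 0 and \<open>C - 1\<close>, a lead
  of 1 in the prefix outweighs the next digit.\<close>

lemma assemble_less_mono:
  assumes "assemble e C L j x < assemble e C L j y" "j \<le> j'" "j' \<le> L"
    "\<And>i. i < L \<Longrightarrow> e i x < C" "\<And>i. i < L \<Longrightarrow> 0 \<le> e i y" "0 \<le> C"
  shows "assemble e C L j' x < assemble e C L j' y"
  using assms(2,3)
proof (induction rule: dec_induct)
  case (step m)
  have "(assemble e C L m x + 1) * C \<le> assemble e C L m y * C"
    by (rule mult_right_mono) (use step assms(6) in auto)
  moreover have "e (L - Suc m) x < C" "0 \<le> e (L - Suc m) y"
    using step assms(4,5) by auto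
  ultimately show ?case by (simp add: algebra_simps)
qed (use assms(1) in simp)

lemma assemble_less:
  assumes "i < L" "node (Suc i) x = node (Suc i) y" "e i x < e i y"
    "\<And>j. i < j \<Longrightarrow> j < L \<Longrightarrow> e j x = e j y"
    "\<And>i. i < L \<Longrightarrow> e i x < C" "\<And>i. i < L \<Longrightarrow> 0 \<le> e i y" "0 \<le> C"
  shows "assemble e C L L x < assemble e C L L y"
proof -
  have *: "L - (L - Suc i) = Suc i" using assms(1) by simp
  have eq: "assemble e C L (L - Suc i) x = assemble e C L (L - Suc i) y"
    by (rule assemble_cong) (use * assms(2,4) in auto)
  have "L - i = Suc (L - Suc i)" using assms(1) by simp
  moreover have "L - Suc (L - Suc i) = i" using assms(1) by simp
  ultimately have "assemble e C L (L - i) x < assemble e C L (L - i) y"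
    using eq assms(3) by simp
  then show ?thesis by (rule assemble_less_mono) (use assms(5-) in auto)
qed

lemma first_difference:
  assumes "x < y" "node L x = node L y"
  shows "\<exists>i<L. node (Suc i) x = node (Suc i) y \<and> dig i x < dig i y"
  using assms
proof (induction L)
  case 0
  then show ?case by (simp add: node_0)
next
  case (Suc L)
  show ?case
  proof (cases "node L x = node L y")
    case True
    with Suc show ?thesis by (meson less_SucI)
  next
    case False
    have "node L x \<le> node L y" using Suc.prems(1) by (simp add: node_def div_le_mono)
    with False have "node L x < node L y" by simp
    then have "dig L x < dig L y"
      unfolding node_dig[of L] Suc.prems(2) by simp
    with Suc.prems(2) show ?thesis by blast
  qed
qed

lemma less_of_div_less: "u div c < v div c \<Longrightarrow> u < (v::nat)"
  by (meson div_le_mono leD leI)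

lemma swap_group_div: "swap_group d div b = (if even (d div b) then d div b + 1 else d div b - 1)"
proof (cases "even (d div b)")
  case True
  then show ?thesis using b_pos by (simp add: swap_group_def)
next
  case False
  then have "b \<le> d" by (metis div_less even_zero not_le)
  with False show ?thesis using le_div_geq[OF b_pos, of d] by (simp add: swap_group_def)
qed

lemma swap_group_less: "d < B \<Longrightarrow> swap_group d < B"
proof -
  assume "d < B"
  then have "d div b < 4" using b_pos by (simp add: B_def less_mult_imp_div_less mult.commute)
  then consider "d div b = 0" | "d div b = 1" | "d div b = 2" | "d div b = 3" by linarith
  then have "swap_group d div b < 4"
    unfolding swap_group_div by cases simp_all
  also have "4 = B div b" using b_pos by (simp add: B_def)
  finally show ?thesis by (rule less_of_div_less)
qed

lemma swap_group_less_same: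
  "d < d' \<Longrightarrow> d div b = d' div b \<Longrightarrow> swap_group d < swap_group d'"
proof -
  assume a: "d < d'" "d div b = d' div b"
  have "b \<le> d" if "odd (d div b)" using that by (metis div_less even_zero not_le)
  with a show ?thesis by (auto simp: swap_group_def)
qed

lemma out_digit_cong:
  assumes "node i x = node i y" "f x = f y \<or> i \<noteq> k"
  shows "out_digit is k f U i x = out_digit is k f U i y"
  using assms by (auto simp: out_digit_def dig_def node_Suc)

lemma out_digit_range:
  assumes "0 \<le> U (node (Suc k) x)" "U (node (Suc k) x) < int M"
  shows "0 \<le> out_digit is k f U i x \<and> out_digit is k f U i x < int (M + B)"
  using assms dig_less[of i x] swap_group_less[OF dig_less[of i x]] dig_less[of k x]
  by (auto simp: out_digit_def)

text \<open>The base \<open>M + B\<close> exceeds every digit, since an offset is below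
  \<open>M\<close> and a digit of the position is below \<open>B\<close>.\<close>

definition entry :: "nat \<Rightarrow> nat \<Rightarrow> nat list \<Rightarrow> nat \<Rightarrow> (nat \<Rightarrow> bool) \<Rightarrow> (nat \<Rightarrow> int) \<Rightarrow> nat \<Rightarrow> int" where
  "entry L M is k f U x = assemble (out_digit is k f U) (int (M + B)) L L x"

definition offset_ok :: "nat \<Rightarrow> nat \<Rightarrow> (nat \<Rightarrow> int) \<Rightarrow> nat \<Rightarrow> bool" where
  "offset_ok M k U x \<longleftrightarrow> 0 \<le> U (node (Suc k) x) \<and> U (node (Suc k) x) < int M"

text \<open>Higher digits agree because they depend on a common ancestor. The exception is digit
  \<open>k\<close>, which also depends on the label; hence the condition on \<open>f\<close> when
  \<open>k\<close> lies above \<open>i\<close>.\<close>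

lemma entry_less:
  assumes "i < L" "node (Suc i) x = node (Suc i) y"
    "out_digit is k f U i x < out_digit is k f U i y"
    "i < k \<longrightarrow> f x = f y" "offset_ok M k U x" "offset_ok M k U y"
  shows "entry L M is k f U x < entry L M is k f U y"
  unfolding entry_def
proof (rule assemble_less[of i])
  fix j assume j: "i < j" "j < L"
  have "node j x = node j y" by (rule node_eq_mono[OF assms(2)]) (use j in simp)
  then show "out_digit is k f U j x = out_digit is k f U j y"
    by (rule out_digit_cong) (use j assms(4) in auto)
qed (use assms out_digit_range[of U k _ M] in \<open>auto simp: offset_ok_def\<close>)

section \<open>Upper bound for increasing subsequences\<close>

lemma finite_node: "finite {x. node l x = p}" and card_node: "card {x. node l x = p} = B ^ l"
proof -
  have "{x. node l x = p} = {p * B ^ l..<p * B ^ l + B ^ l}"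
    using B_pos dividend_less_div_times[of "B ^ l"]
    by (auto simp: node_def intro!: div_nat_eqI) (simp_all add: algebra_simps)
  then show "finite {x. node l x = p}" "card {x. node l x = p} = B ^ l" by auto
qed

lemma card_children:
  "card {x. node (Suc l) x = p \<and> R x} = (\<Sum>d<B. card {x. node l x = p * B + d \<and> R x})"
proof -
  have eq: "{x. node (Suc l) x = p \<and> R x} = (\<Union>d<B. {x. node l x = p * B + d \<and> R x})"
    using dig_less[of l] node_dig[of l] B_pos by (auto simp: node_Suc)
  show ?thesis unfolding eq
    by (rule card_UN_disjoint) (auto intro: finite_subset[OF _ finite_node])
qed

text \<open>The bound for the density of an increasing subsequence in a node with secret
  \<open>s\<close> and \<open>t\<close> chosen levels below. For \<open>t = 0\<close> and secret 0
  it is \<open>1 / B\<close>, one child out of \<open>B\<close>.\<close>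

definition lis_frac :: "nat \<Rightarrow> bool \<Rightarrow> real" where
  "lis_frac t s = 1 / 2 ^ t - (if s then 0 else (1 - 1 / real B) / 4 ^ t)"

lemma lis_frac_False_le_True: "lis_frac t False \<le> lis_frac t True"
  using B_gt_1 by (simp add: lis_frac_def)

lemma lis_frac_nonneg: "0 \<le> lis_frac t s"
proof -
  have "(1 - 1 / real B) / 4 ^ t \<le> 1 / 4 ^ t" by (intro divide_right_mono) auto
  also have "\<dots> \<le> 1 / (2::real) ^ t" by (intro divide_left_mono power_mono) auto
  finally show ?thesis by (auto simp: lis_frac_def)
qed

lemma lis_frac_Suc_True: "lis_frac (Suc t) True = lis_frac t True / 2"
  by (simp add: lis_frac_def)

lemma lis_frac_Suc_False: "lis_frac (Suc t) False = (lis_frac t True + lis_frac t False) / 4"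
  by (simp add: lis_frac_def field_simps)

definition child_secret :: "bool \<Rightarrow> bool \<Rightarrow> nat \<Rightarrow> bool" where
  "child_secret r s g \<longleftrightarrow> (r \<noteq> (s \<and> odd g)) \<noteq> (2 \<le> g)"

lemma child_eq: "child \<rho> s i x = child_secret ((i, node (Suc i) x) \<in> \<rho>) s (grp i x)"
  by (simp add: child_def child_secret_def)

text \<open>For \<open>s\<close> true, each pair of groups contains one secret 1. For
  \<open>s\<close> false, one pair has secret 1 twice and the other has secret 0 twice. The bit
  \<open>r\<close> only exchanges roles, so it does not affect the sum.\<close>

lemma max_lis_frac_children:
  "max (lis_frac t (child_secret r s 0)) (lis_frac t (child_secret r s 1)) +
   max (lis_frac t (child_secret r s 2)) (lis_frac t (child_secret r s 3)) = 4 * lis_frac (Suc t) s"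
  using lis_frac_False_le_True[of t]
  by (cases r; cases s; simp add: child_secret_def lis_frac_Suc_True lis_frac_Suc_False max_def)

lemma card_le_one_child:
  assumes "finite S" "\<And>x y. x \<in> S \<Longrightarrow> y \<in> S \<Longrightarrow> node l x = node l y"
  shows "card S \<le> B ^ l"
proof (cases "S = {}")
  case False
  then obtain x where "x \<in> S" by auto
  then have "S \<subseteq> {y. node l y = node l x}" using assms(2) by blast
  then show ?thesis using card_mono[OF finite_node] card_node by metis
qed simp

text \<open>Induction on the height. The values depend on all chosen levels \<open>ups\<close>,
  whereas \<open>is\<close> lists those still below \<open>l\<close>. The label \<open>f\<close> is
  kept separate from \<open>label \<rho> s is\<close>, so that the values stay fixed while the
  induction restarts at a child with the secret of that child.\<close>

lemma card_monotone_le: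
  fixes L M k :: nat and ups :: "nat list" and f :: "nat \<Rightarrow> bool" and U :: "nat \<Rightarrow> int"
  defines "V \<equiv> entry L M ups k f U"
  assumes "\<And>x y. x \<in> S \<Longrightarrow> y \<in> S \<Longrightarrow> x < y \<Longrightarrow> V x \<le> V y"
    "\<And>x. x \<in> S \<Longrightarrow> offset_ok M k U x"
    "k < l" "l \<le> L" "S \<subseteq> {x. node l x = p}" "sorted_wrt (>) (is @ [k])"
    "set ups \<inter> {..<l} = set is" "\<And>x. x \<in> S \<Longrightarrow> f x = label \<rho> s is x"
  shows "real (card S) \<le> lis_frac (length is) s * B ^ l"
  using assms(2-)
proof (induction l arbitrary: S p s "is")
  case 0
  then show ?case by simp
next
  case (Suc l)
  note inc = Suc.prems(1) and ok = Suc.prems(2)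
  have l: "l < L" "k \<le> l" using Suc.prems by auto
  have S: "S \<subseteq> {x. node (Suc l) x = p}" using Suc.prems by auto
  have fin: "finite S" by (rule finite_subset[OF S finite_node])
  define C where "C d = {x \<in> S. node l x = p * B + d}" for d
  have S_eq: "S = {x. node (Suc l) x = p \<and> x \<in> S}" using S by auto
  have cardS: "card S = (\<Sum>d<B. card (C d))"
    by (subst S_eq, subst card_children) (auto simp: C_def conj_commute)
  show ?case
  proof (cases "l = k")
    case True
    have "set is = {}"
    proof -
      have "k < i \<and> i < Suc l" if "i \<in> set is" for i
        using that Suc.prems(6,7) by (auto simp: sorted_wrt_append)
      with True show ?thesis by (metis all_not_in_conv less_antisym less_asym less_imp_neq)
    qed
    then have "is": "is = []" by simp
    show ?thesis
    proof (cases s)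
      case True
      have "card S \<le> card {x. node (Suc l) x = p}" by (rule card_mono[OF finite_node S])
      also have "\<dots> = B ^ Suc l" by (rule card_node)
      finally have "real (card S) \<le> real (B ^ Suc l)" by (simp only: of_nat_le_iff)
      with True show ?thesis by (simp add: lis_frac_def "is")
    next
      case False
      \<comment> \<open>With secret 0 the children are in decreasing order, so \<open>S\<close>
        meets only one of them.\<close>
      have "card S \<le> B ^ l"
      proof (rule card_le_one_child[OF fin], rule ccontr)
        fix x y assume xy: "x \<in> S" "y \<in> S" "node l x \<noteq> node l y"
        have *: "\<not> dig k x < dig k y" if xy: "x \<in> S" "y \<in> S" for x y
        proof
          assume dlt: "dig k x < dig k y"
          have N: "node (Suc k) y = node (Suc k) x" using S xy \<open>l = k\<close> by auto
          have "V y < V x" unfolding V_def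
          proof (rule entry_less[OF _ N])
            show "out_digit ups k f U k y < out_digit ups k f U k x"
              using dlt dig_less[of k x] dig_less[of k y] Suc.prems(8) xy False "is"
              by (simp add: out_digit_def N)
          qed (use l ok xy \<open>l = k\<close> in auto)
          moreover have "x < y"
          proof (rule less_of_div_less)
            show "x div B ^ k < y div B ^ k"
              using dlt N node_dig[of k x] node_dig[of k y] by (simp add: node_def)
          qed
          ultimately show False using inc[OF xy] by simp
        qed
        have "node (Suc l) x = node (Suc l) y" using S xy by auto
        with xy(3) have "dig l x \<noteq> dig l y" by (metis node_dig)
        with *[OF xy(1,2)] *[OF xy(2,1)] \<open>l = k\<close> show False by simp
      qed
      then have "real (card S) \<le> real (B ^ l)" by (simp only: of_nat_le_iff)
      with False B_pos show ?thesis by (simp add: lis_frac_def "is")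
    qed
  next
    case False
    with l have kl: "k < l" by simp
    show ?thesis
    proof (cases "l \<in> set is")
      case lis: False
      have "real (card (C d)) \<le> lis_frac (length is) s * B ^ l" for d
      proof (rule Suc.IH)
        show "set ups \<inter> {..<l} = set is"
        proof -
          have "set ups \<inter> {..<l} = (set ups \<inter> {..<Suc l}) - {l}" by auto
          with lis show ?thesis unfolding Suc.prems(7) by simp
        qed
        show "C d \<subseteq> {x. node l x = p * B + d}" by (auto simp: C_def)
        show "V x \<le> V y" if "x \<in> C d" "y \<in> C d" "x < y" for x y
          using inc that by (simp add: C_def)
        show "offset_ok M k U x" if "x \<in> C d" for x using ok that by (simp add: C_def)
        show "f x = label \<rho> s is x" if "x \<in> C d" for x
          using Suc.prems(8) that by (simp add: C_def)
      qed (use Suc.prems(4,6) kl in simp_all)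
      then have "(\<Sum>d<B. real (card (C d))) \<le> (\<Sum>d<B. lis_frac (length is) s * B ^ l)"
        by (rule sum_mono)
      then show ?thesis unfolding cardS by (simp add: mult_ac)
    next
      case lis: True
      then obtain js where "is": "is = l # js"
      proof (cases "is")
        case (Cons j js)
        have "j < Suc l" using Suc.prems(7) Cons by auto
        with Cons lis Suc.prems(6) have "j = l" by auto
        with Cons that show ?thesis by simp
      qed simp
      have lis0: "l \<in> set ups" using lis Suc.prems(7) by auto
      define r where "r = ((l, p) \<in> \<rho>)"
      define X where "X g = {x \<in> S. grp l x = g}" for g
      have finX: "finite (X g)" for g using fin by (simp add: X_def)
      \<comment> \<open>A group consists of \<open>b\<close> children with the same secret, and the
        induction hypothesis is applied to each of them with this secret.\<close>
      have X_le: "real (card (X g)) \<le> real b * (lis_frac (length js) (child_secret r s g) * B ^ l)" for g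
      proof -
        have "real (card (C d \<inter> X g)) \<le> lis_frac (length js) (child_secret r s g) * B ^ l" for d
        proof (rule Suc.IH)
          show "C d \<inter> X g \<subseteq> {x. node l x = p * B + d}" by (auto simp: C_def)
          show "set ups \<inter> {..<l} = set js"
          proof -
            have "set js \<subseteq> {..<l}" using Suc.prems(6) "is" by auto
            moreover have "set ups \<inter> {..<l} = (set ups \<inter> {..<Suc l}) - {l}" by auto
            ultimately show ?thesis unfolding Suc.prems(7) "is" by auto
          qed
          show "f x = label \<rho> (child_secret r s g) js x" if "x \<in> C d \<inter> X g" for x
          proof -
            have "x \<in> S" "node (Suc l) x = p" "grp l x = g" using that S by (auto simp: C_def X_def)
            with Suc.prems(8)[of x] show ?thesis by (simp add: "is" child_eq r_def)
          qed
          show "V x \<le> V y" if "x \<in> C d \<inter> X g" "y \<in> C d \<inter> X g" "x < y" for x y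
            using inc that by (simp add: C_def)
          show "offset_ok M k U x" if "x \<in> C d \<inter> X g" for x using ok that by (simp add: C_def)
        qed (use Suc.prems(4,6) kl "is" in simp_all)
        then have "(\<Sum>d=g*b..<g*b+b. real (card (C d \<inter> X g))) \<le>
            (\<Sum>d=g*b..<g*b+b. lis_frac (length js) (child_secret r s g) * B ^ l)"
          by (intro sum_mono)
        then have sum_le: "real (\<Sum>d=g*b..<g*b+b. card (C d \<inter> X g)) \<le>
            (\<Sum>d=g*b..<g*b+b. lis_frac (length js) (child_secret r s g) * B ^ l)"
          by (simp only: of_nat_sum)
        have "X g \<subseteq> (\<Union>d\<in>{g*b..<g*b+b}. C d \<inter> X g)"
        proof
          fix x assume x: "x \<in> X g"
          then have "dig l x div b = g" "node l x = p * B + dig l x"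
            using S node_dig[of l x] by (auto simp: X_def grp_def)
          moreover from this(1) have "dig l x \<in> {g*b..<g*b+b}"
            using dividend_less_div_times[OF b_pos, of "dig l x"] by (auto simp: mult.commute)
          ultimately show "x \<in> (\<Union>d\<in>{g*b..<g*b+b}. C d \<inter> X g)"
            using x by (auto simp: C_def X_def)
        qed
        then have "card (X g) \<le> card (\<Union>d\<in>{g*b..<g*b+b}. C d \<inter> X g)"
          by (rule card_mono[rotated]) (use finX in auto)
        also have "\<dots> \<le> (\<Sum>d=g*b..<g*b+b. card (C d \<inter> X g))"
          by (rule card_UN_le) simp
        finally have card_le: "card (X g) \<le> (\<Sum>d=g*b..<g*b+b. card (C d \<inter> X g))" .
        have "real (card (X g)) \<le> (\<Sum>d=g*b..<g*b+b. lis_frac (length js) (child_secret r s g) * B ^ l)"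
          using of_nat_mono[OF card_le, where 'a = real] sum_le by linarith
        then show ?thesis by simp
      qed
      \<comment> \<open>The exchange puts the values of group \<open>g + 1\<close> below those of
        group \<open>g\<close>, so an increasing sequence cannot meet both.\<close>
      have excl: "X g = {} \<or> X (g + 1) = {}" if "even g" for g
      proof (rule ccontr)
        assume "\<not> ?thesis"
        then obtain x y where xy: "x \<in> S" "y \<in> S" "grp l x = g" "grp l y = g + 1"
          by (auto simp: X_def)
        have N: "node (Suc l) y = node (Suc l) x" using S xy by auto
        have lt: "dig l x < dig l y"
          by (rule less_of_div_less[of _ b]) (use xy in \<open>simp add: grp_def\<close>)
        have "V y < V x" unfolding V_def
        proof (rule entry_less[OF l(1) N])
          have "swap_group (dig l y) < swap_group (dig l x)"
            by (rule less_of_div_less[of _ b]) (use xy that in \<open>simp add: grp_def swap_group_div\<close>)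
          then show "out_digit ups k f U l y < out_digit ups k f U l x"
            using kl lis0 by (simp add: out_digit_def)
        qed (use kl ok xy in auto)
        moreover have "x < y"
        proof (rule less_of_div_less)
          show "x div B ^ l < y div B ^ l"
            using lt N node_dig[of l x] node_dig[of l y] by (simp add: node_def)
        qed
        ultimately show False using inc[OF xy(1,2)] by simp
      qed
      define K where "K = real b * B ^ l"
      have K: "0 \<le> K" by (simp add: K_def)
      have pair: "real (card (X g)) + real (card (X (g + 1))) \<le>
          K * max (lis_frac (length js) (child_secret r s g)) (lis_frac (length js) (child_secret r s (g + 1)))"
        if "even g" for g
      proof -
        have 1: "real (card (X h)) \<le> K * lis_frac (length js) (child_secret r s h)" for h
          using X_le[of h] by (simp add: K_def mult_ac)
        have 2: "K * lis_frac (length js) (child_secret r s h) \<le>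
          K * max (lis_frac (length js) (child_secret r s g)) (lis_frac (length js) (child_secret r s (g + 1)))"
          if "h = g \<or> h = g + 1" for h using that K by (intro mult_left_mono) auto
        have "real (card (X h)) \<le>
          K * max (lis_frac (length js) (child_secret r s g)) (lis_frac (length js) (child_secret r s (g + 1)))"
          if "h = g \<or> h = g + 1" for h by (rule order_trans[OF 1 2[OF that]])
        then show ?thesis using excl[OF \<open>even g\<close>] by auto
      qed
      have "S \<subseteq> X 0 \<union> X 1 \<union> X 2 \<union> X 3"
      proof
        fix x assume "x \<in> S"
        moreover from grp_less[of l x] have "grp l x = 0 \<or> grp l x = 1 \<or> grp l x = 2 \<or> grp l x = 3"
          by linarith
        ultimately show "x \<in> X 0 \<union> X 1 \<union> X 2 \<union> X 3" by (auto simp: X_def)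
      qed
      then have "card S \<le> card (X 0 \<union> X 1 \<union> X 2 \<union> X 3)"
        by (rule card_mono[rotated]) (use finX in auto)
      also have "\<dots> \<le> card (X 0) + card (X 1) + card (X 2) + card (X 3)"
        by (meson card_Un_le add_mono order_trans order_refl)
      finally have "real (card S) \<le> (real (card (X 0)) + real (card (X 1)))
          + (real (card (X 2)) + real (card (X 3)))" by linarith
      also have "\<dots> \<le> K * (max (lis_frac (length js) (child_secret r s 0)) (lis_frac (length js) (child_secret r s 1)) +
         max (lis_frac (length js) (child_secret r s 2)) (lis_frac (length js) (child_secret r s 3)))"
        using pair[of 0] pair[of 2] by (simp add: distrib_left)
      also have "\<dots> = lis_frac (length is) s * B ^ Suc l"
        unfolding max_lis_frac_children by (simp add: K_def "is" B_def)
      finally show ?thesis .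
    qed
  qed
qed

end

section \<open>Distance to monotonicity in terms of increasing subsequences\<close>

lemma dist_to_mono_ge:
  assumes "\<And>S. S \<subseteq> {1..n} \<Longrightarrow> (\<And>i j. i \<in> S \<Longrightarrow> j \<in> S \<Longrightarrow> i < j \<Longrightarrow> A i \<le> A j) \<Longrightarrow> real (card S) \<le> K"
  shows "real n - K \<le> real (dist_to_mono n A)"
proof -
  have "dist_to_mono n A \<in> {card {i \<in> {1..n}. A i \<noteq> B i} | B. mono_on {1..n} B}"
    unfolding dist_to_mono_def by (rule Inf_nat_def1) (auto intro!: exI[of _ "\<lambda>_. 0"] mono_onI)
  then obtain B where B: "dist_to_mono n A = card {i \<in> {1..n}. A i \<noteq> B i}" "mono_on {1..n} B" by auto
  define S where "S = {i \<in> {1..n}. A i = B i}"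
  have "real (card S) \<le> K"
    by (rule assms) (use B(2) in \<open>auto simp: S_def intro: mono_onD\<close>)
  moreover have "card S + card {i \<in> {1..n}. A i \<noteq> B i} = card (S \<union> {i \<in> {1..n}. A i \<noteq> B i})"
    by (rule card_Un_disjoint[symmetric]) (auto simp: S_def)
  moreover have "S \<union> {i \<in> {1..n}. A i \<noteq> B i} = {1..n}" by (auto simp: S_def)
  ultimately show ?thesis using B(1) by auto
qed

lemma dist_to_mono_le:
  assumes "S \<subseteq> {1..n}" "\<And>i j. i \<in> S \<Longrightarrow> j \<in> S \<Longrightarrow> i < j \<Longrightarrow> A i \<le> A j"
  shows "dist_to_mono n A \<le> n - card S"
proof -
  have fin: "finite S" using assms(1) finite_subset by blast
  define m where "m = Min (A ` {1..n})"
  \<comment> \<open>The running maximum of the kept values; \<open>m\<close>, the least value of the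
    array, serves the positions before the first kept one.\<close>
  define B where "B i = Max (insert m (A ` {j \<in> S. j \<le> i}))" for i
  have mono: "mono_on {1..n} B"
    by (rule mono_onI) (unfold B_def, rule Max_mono, use fin in auto)
  have "A i = B i" if "i \<in> S" for i
    unfolding B_def
  proof (rule Max_eqI[symmetric])
    fix y assume "y \<in> insert m (A ` {j \<in> S. j \<le> i})"
    then consider "y = m" | j where "j \<in> S" "j \<le> i" "y = A j" by auto
    then show "y \<le> A i"
    proof cases
      case 1
      then show ?thesis using that assms(1) by (auto simp: m_def intro!: Min_le)
    next
      case 2
      then show ?thesis using assms(2)[of j i] that by (cases "j = i") auto
    qed
  qed (use fin that in auto)
  then have "{i \<in> {1..n}. A i \<noteq> B i} \<subseteq> {1..n} - S" by auto
  then have "card {i \<in> {1..n}. A i \<noteq> B i} \<le> card ({1..n} - S)" by (rule card_mono[rotated]) simp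
  also have "\<dots> = n - card S" using assms(1) fin by (simp add: card_Diff_subset)
  finally have "card {i \<in> {1..n}. A i \<noteq> B i} \<le> n - card S" .
  moreover have "dist_to_mono n A \<le> card {i \<in> {1..n}. A i \<noteq> B i}"
    unfolding dist_to_mono_def by (rule cInf_lower) (use mono in auto)
  ultimately show ?thesis by simp
qed

section \<open>Long increasing sequences for secret 1, and the distances of both kinds of
  arrays\<close>

context quaternary_base
begin

text \<open>Starting with secret 1, every chosen level is passed through a child that again has
  secret 1. These positions form the long increasing sequence of a close array.\<close>

definition secret_path :: "(nat \<times> nat) set \<Rightarrow> nat set \<Rightarrow> nat \<Rightarrow> bool" where
  "secret_path \<rho> I x \<longleftrightarrow> (\<forall>i\<in>I. child \<rho> True i x)"

lemma label_secret_path: "secret_path \<rho> (set is) x \<Longrightarrow> label \<rho> True is x"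
proof (induction "is")
  case (Cons i "is")
  then have "child \<rho> True i x" "secret_path \<rho> (set is) x" by (simp_all add: secret_path_def)
  with Cons.IH show ?case by simp
qed simp

lemma entry_less_top:
  assumes "node L x < node L y" "offset_ok M k U x" "offset_ok M k U y"
  shows "entry L M is k f U x < entry L M is k f U y"
  unfolding entry_def
  by (rule assemble_less_mono[of _ _ _ 0])
     (use assms out_digit_range[of U k _ M] in \<open>auto simp: offset_ok_def\<close>)

text \<open>Below a node with secret 1, the groups with secret 1 are 0 and 3 or else 1 and 2, one
  from each exchanged pair; so the exchange keeps their order.\<close>

lemma child_secret_groups:
  assumes "child_secret r True g" "child_secret r True g'" "g < g'" "g' < 4"
  shows "(if even g then g + 1 else g - 1) < (if even g' then g' + 1 else g' - 1)"
proof -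
  consider "g = 0" "g' = 1" | "g = 0" "g' = 2" | "g = 0" "g' = 3"
    | "g = 1" "g' = 2" | "g = 1" "g' = 3" | "g = 2" "g' = 3"
    using assms(3,4) by linarith
  then show ?thesis using assms(1,2) by cases (auto simp: child_secret_def)
qed

lemma entry_less_secret_path:
  assumes "x < y" "secret_path \<rho> (set is) x" "secret_path \<rho> (set is) y" "k \<notin> set is"
    "f x" "f y" "offset_ok M k U x" "offset_ok M k U y"
  shows "entry L M is k f U x < entry L M is k f U y"
proof (cases "node L x = node L y")
  case False
  moreover have "node L x \<le> node L y" using assms(1) by (simp add: node_def div_le_mono)
  ultimately show ?thesis by (intro entry_less_top assms) simp
next
  case True
  from first_difference[OF assms(1) this] obtain i where
    i: "i < L" "node (Suc i) x = node (Suc i) y" "dig i x < dig i y" by auto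
  show ?thesis
  proof (rule entry_less[OF i(1,2)])
    have "swap_group (dig i x) < swap_group (dig i y)" if "i \<in> set is"
    proof (cases "grp i x = grp i y")
      case True
      then show ?thesis using i(3) by (intro swap_group_less_same) (auto simp: grp_def)
    next
      case False
      have "grp i x \<le> grp i y" using i(3) by (simp add: grp_def div_le_mono)
      with False have lt: "grp i x < grp i y" by linarith
      have "child \<rho> True i x" "child \<rho> True i y"
        using assms(2,3) that by (auto simp: secret_path_def)
      then have "child_secret ((i, node (Suc i) y) \<in> \<rho>) True (grp i x)"
          "child_secret ((i, node (Suc i) y) \<in> \<rho>) True (grp i y)"
        by (simp_all only: child_eq i(2))
      from child_secret_groups[OF this lt grp_less]
      have "swap_group (dig i x) div b < swap_group (dig i y) div b"
        unfolding swap_group_div grp_def .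
      then show ?thesis by (rule less_of_div_less)
    qed
    then show "out_digit is k f U i x < out_digit is k f U i y"
      using i assms by (auto simp: out_digit_def)
  qed (use assms in auto)
qed

lemma card_secret_groups: "card {d \<in> {..<B}. child_secret r True (d div b)} = 2 * b"
proof -
  have div: "d div b = g \<longleftrightarrow> g * b \<le> d \<and> d < g * b + b" for d g
    using b_pos dividend_less_div_times[OF b_pos, of d]
    by (auto intro!: div_nat_eqI simp: mult.commute)
  have four: "d div b = 0 \<or> d div b = 1 \<or> d div b = 2 \<or> d div b = 3" if "d < B" for d
    using that b_pos less_mult_imp_div_less[of d 4 b] by (auto simp: B_def mult.commute)
  have cs: "child_secret r True (d div b) \<longleftrightarrow>
      (if r then d div b = 0 \<or> d div b = 3 else d div b = 1 \<or> d div b = 2)" if "d < B" for d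
    using four[OF that] by (elim disjE) (simp_all add: child_secret_def)
  show ?thesis
  proof (cases r)
    case True
    have "{d \<in> {..<B}. child_secret r True (d div b)} = {d \<in> {..<B}. d div b = 0 \<or> d div b = 3}"
      using True cs by auto
    also have "\<dots> = {0..<b} \<union> {3 * b..<4 * b}" unfolding div by (auto simp: B_def)
    also have "card \<dots> = card {0..<b} + card {3 * b..<4 * b}" by (rule card_Un_disjoint) auto
    finally show ?thesis by simp
  next
    case False
    have "{d \<in> {..<B}. child_secret r True (d div b)} = {d \<in> {..<B}. d div b = 1 \<or> d div b = 2}"
      using False cs by auto
    also have "\<dots> = {b..<3 * b}" unfolding div by (auto simp: B_def)
    finally show ?thesis by simp
  qed
qed

text \<open>Two of the four groups survive at a chosen level and all children at any other level, so
  each chosen level halves the density.\<close>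

lemma card_secret_path:
  "card {x. node l x = p \<and> secret_path \<rho> (I \<inter> {..<l}) x} * 2 ^ card (I \<inter> {..<l}) = B ^ l"
proof (induction l arbitrary: p)
  case 0
  then show ?case by (simp add: secret_path_def node_0)
next
  case (Suc l)
  define N where "N = B ^ l"
  define c where "c = card (I \<inter> {..<l})"
  define R where "R x = secret_path \<rho> (I \<inter> {..<l}) x" for x
  have IH: "card {x. node l x = q \<and> R x} * 2 ^ c = N" for q
    using Suc by (simp add: N_def c_def R_def)
  show ?case
  proof (cases "l \<in> I")
    case False
    then have "I \<inter> {..<Suc l} = I \<inter> {..<l}" by (auto simp: less_Suc_eq)
    then show ?thesis
      using card_children[of l p R] IH by (simp add: sum_distrib_right N_def c_def R_def)
  next
    case True
    then have I: "I \<inter> {..<Suc l} = insert l (I \<inter> {..<l})" by auto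
    define r where "r = ((l, p) \<in> \<rho>)"
    have "card {x. node l x = p * B + d \<and> secret_path \<rho> (I \<inter> {..<Suc l}) x} * 2 ^ c =
        (if child_secret r True (d div b) then N else 0)" if "d < B" for d
    proof -
      have "child \<rho> True l x = child_secret r True (d div b)" if "node l x = p * B + d" for x
        using that \<open>d < B\<close> by (simp add: child_eq grp_def dig_def node_Suc r_def)
      then have "{x. node l x = p * B + d \<and> secret_path \<rho> (I \<inter> {..<Suc l}) x} =
          (if child_secret r True (d div b) then {x. node l x = p * B + d \<and> R x} else {})"
        unfolding I by (auto simp: secret_path_def R_def)
      then show ?thesis using IH by simp
    qed
    then have "(\<Sum>d<B. card {x. node l x = p * B + d \<and> secret_path \<rho> (I \<inter> {..<Suc l}) x} * 2 ^ c) =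
        (\<Sum>d<B. if child_secret r True (d div b) then N else 0)" by (intro sum.cong) auto
    also have "\<dots> = 2 * b * N"
      using card_secret_groups[of r] by (simp add: sum.If_cases Int_def)
    finally have "(\<Sum>d<B. card {x. node l x = p * B + d \<and> secret_path \<rho> (I \<inter> {..<Suc l}) x}) * 2 ^ Suc c
        = 4 * b * N" unfolding sum_distrib_right[symmetric] by (simp add: mult_ac)
    moreover have "card (I \<inter> {..<Suc l}) = Suc c" unfolding I by (simp add: c_def)
    ultimately show ?thesis unfolding card_children by (simp add: N_def B_def)
  qed
qed

text \<open>Only the complete nodes of height \<open>L\<close> are counted; the incomplete last one
  contains fewer than \<open>B ^ L\<close> positions.\<close>

lemma card_secret_path_ge:
  assumes "I \<subseteq> {..<L}" "card I = t"
  shows "(real n - B ^ L) / 2 ^ t \<le> real (card {x \<in> {..<n}. secret_path \<rho> I x})"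
proof -
  define N where "N = B ^ L"
  have N: "N > 0" using B_pos by (simp add: N_def)
  have each: "real (card {x. node L x = p \<and> secret_path \<rho> I x}) = N / 2 ^ t" for p
  proof -
    have "I \<inter> {..<L} = I" using assms by auto
    then have "card {x. node L x = p \<and> secret_path \<rho> I x} * 2 ^ t = N"
      using card_secret_path[of L p \<rho> I] assms by (simp add: N_def)
    from arg_cong[OF this, of real] show ?thesis by (simp add: field_simps)
  qed
  have "real n \<le> real (n div N * N) + real N"
    using mod_less_divisor[OF N, of n] div_mult_mod_eq[of n N] by linarith
  then have "real n - N \<le> real (n div N) * N" by simp
  from divide_right_mono[OF this, of "2 ^ t"]
  have "(real n - N) / 2 ^ t \<le> real (n div N) * (N / 2 ^ t)" by simp
  also have "\<dots> = (\<Sum>p<n div N. real (card {x. node L x = p \<and> secret_path \<rho> I x}))"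
    by (simp add: each)
  also have "\<dots> = real (card (\<Union>p<n div N. {x. node L x = p \<and> secret_path \<rho> I x}))"
    by (subst card_UN_disjoint) (auto intro: finite_subset[OF _ finite_node])
  also have "\<dots> \<le> real (card {x \<in> {..<n}. secret_path \<rho> I x})"
    by (intro of_nat_mono card_mono) (auto simp: node_def N_def intro: less_of_div_less)
  finally show ?thesis by (simp add: N_def)
qed

text \<open>The positions \<open>1..n\<close> of the array are moved to \<open>0..n - 1\<close>,
  which are the positions written in base \<open>B\<close>.\<close>

definition array :: "nat \<Rightarrow> nat \<Rightarrow> nat list \<Rightarrow> nat \<Rightarrow> bool \<Rightarrow> (nat \<times> nat) set \<Rightarrow> (nat \<Rightarrow> int) \<Rightarrow> nat \<Rightarrow> real" where
  "array L M is k s \<rho> U i = real_of_int (entry L M is k (label \<rho> s is) U (i - 1))"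

lemma dist_array_True_le:
  assumes "set is \<subseteq> {..<L}" "sorted_wrt (>) (is @ [k])" "\<And>x. x < n \<Longrightarrow> offset_ok M k U x"
  shows "real (dist_to_mono n (array L M is k True \<rho> U)) \<le> real n - (real n - B ^ L) / 2 ^ length is"
proof -
  define S where "S = Suc ` {x \<in> {..<n}. secret_path \<rho> (set is) x}"
  have S: "S \<subseteq> {1..n}" by (auto simp: S_def)
  have k: "k \<notin> set is" using assms(2) by (auto simp: sorted_wrt_append)
  have "dist_to_mono n (array L M is k True \<rho> U) \<le> n - card S"
  proof (rule dist_to_mono_le[OF S])
    fix i j assume "i \<in> S" "j \<in> S" "i < j"
    then show "array L M is k True \<rho> U i \<le> array L M is k True \<rho> U j"
      using k assms(3)
      by (auto simp: S_def array_def intro!: less_imp_le entry_less_secret_path label_secret_path)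
  qed
  moreover have "card S \<le> n" using card_mono[OF _ S] by simp
  moreover have "card S = card {x \<in> {..<n}. secret_path \<rho> (set is) x}"
    by (simp add: S_def card_image)
  moreover have "sorted_wrt (>) xs \<Longrightarrow> distinct xs" for xs :: "nat list"
    by (induction xs) auto
  then have "distinct is" using assms(2) by (simp add: sorted_wrt_append)
  then have "card (set is) = length is" by (rule distinct_card)
  note card_secret_path_ge[OF assms(1) this, of n \<rho>]
  ultimately show ?thesis by linarith
qed

lemma dist_array_False_ge:
  assumes "set is \<subseteq> {..<L}" "sorted_wrt (>) (is @ [k])" "\<And>x. x < n \<Longrightarrow> offset_ok M k U x" "k < L"
  shows "real n - (real n + B ^ L) * lis_frac (length is) False
           \<le> real (dist_to_mono n (array L M is k False \<rho> U))"
proof (rule dist_to_mono_ge)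
  fix S assume S: "S \<subseteq> {1..n}" and
    mono: "\<And>i j. i \<in> S \<Longrightarrow> j \<in> S \<Longrightarrow> i < j \<Longrightarrow> array L M is k False \<rho> U i \<le> array L M is k False \<rho> U j"
  define S' where "S' = (\<lambda>i. i - 1) ` S"
  define N where "N = B ^ L"
  have card: "card S' = card S"
    unfolding S'_def
  proof (intro card_image inj_onI)
    fix i j assume "i \<in> S" "j \<in> S" "i - 1 = j - 1"
    moreover from this S have "1 \<le> i" "1 \<le> j" by auto
    ultimately show "i = j" by linarith
  qed
  have S': "S' \<subseteq> {..<n}" using S by (fastforce simp: S'_def)
  then have fin: "finite S'" by (rule finite_subset) simp
  have inc: "entry L M is k (label \<rho> False is) U x \<le> entry L M is k (label \<rho> False is) U y"
    if "x \<in> S'" "y \<in> S'" "x < y" for x y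
  proof -
    from that obtain i j where "i \<in> S" "j \<in> S" "x = i - 1" "y = j - 1" "i < j" by (auto simp: S'_def)
    with mono[of i j] show ?thesis by (simp add: array_def)
  qed
  have each: "real (card {x \<in> S'. node L x = p}) \<le> lis_frac (length is) False * B ^ L" for p
    by (rule card_monotone_le[where L = L and M = M and ups = "is" and U = U
          and f = "label \<rho> False is" and \<rho> = \<rho> and k = k and p = p])
       (use inc S' assms in auto)
  \<comment> \<open>The last node may be incomplete, so one node more than \<open>n div N\<close> is
    allowed for; this accounts for the extra \<open>B ^ L\<close> in the bound.\<close>
  have "S' \<subseteq> (\<Union>p\<le>n div N. {x \<in> S'. node L x = p})"
  proof
    fix x assume x: "x \<in> S'"
    then have "x \<le> n" using subsetD[OF S'] by (simp add: less_imp_le)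
    then have "node L x \<le> n div N" unfolding node_def N_def by (rule div_le_mono)
    with x show "x \<in> (\<Union>p\<le>n div N. {x \<in> S'. node L x = p})" by auto
  qed
  then have "card S' \<le> card (\<Union>p\<le>n div N. {x \<in> S'. node L x = p})"
    by (rule card_mono[rotated]) (use fin in auto)
  also have "\<dots> \<le> (\<Sum>p\<le>n div N. card {x \<in> S'. node L x = p})" by (rule card_UN_le) simp
  finally have "real (card S') \<le> real (\<Sum>p\<le>n div N. card {x \<in> S'. node L x = p})" by (rule of_nat_mono)
  also have "\<dots> \<le> (\<Sum>p\<le>n div N. lis_frac (length is) False * B ^ L)"
    unfolding of_nat_sum by (rule sum_mono) (rule each)
  also have "\<dots> = (real (n div N * N) + real N) * lis_frac (length is) False"
    by (simp add: N_def algebra_simps)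
  also have "\<dots> \<le> (real n + real N) * lis_frac (length is) False"
  proof (intro mult_right_mono add_mono lis_frac_nonneg)
    show "real (n div N * N) \<le> real n" by (rule of_nat_mono) simp
  qed simp
  finally show "real (card S) \<le> (real n + B ^ L) * lis_frac (length is) False"
    by (simp add: card N_def)
qed

end

subsection \<open>Indistinguishability\<close>

lemma card_shift_out:
  assumes "\<bar>c\<bar> \<le> int K"
  shows "card {u \<in> {0..<int M}. u + c \<notin> {0..<int M}} \<le> K"
proof -
  have "card {u \<in> {0..<int M}. u + c \<notin> {0..<int M}} \<le> card (if c \<ge> 0 then {int M - c..<int M} else {0..<- c})"
    by (rule card_mono) auto
  also have "\<dots> \<le> K" using assms by auto
  finally show ?thesis .
qed

text \<open>Uniform offsets hide a bounded shift: the shift is injective, and a point that leaves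
  the cube leaves it in one of \<open>n\<close> coordinates, each of which accounts for at most a
  fraction \<open>K / M\<close> of the points.\<close>

lemma sum_shift_le:
  fixes g :: "(nat \<Rightarrow> int) \<Rightarrow> real" and n M :: nat
  defines "cube \<equiv> {..<n} \<rightarrow>\<^sub>E {0..<int M}"
  assumes g: "\<And>U. 0 \<le> g U" "\<And>U. g U \<le> 1" and c: "\<And>p. \<bar>c p\<bar> \<le> int K" and "M > 0"
  shows "(\<Sum>U\<in>cube. g (\<lambda>p\<in>{..<n}. U p + c p)) \<le> (\<Sum>U\<in>cube. g U) + real n * K / M * M ^ n"
proof -
  define \<sigma> where "\<sigma> U = (\<lambda>p\<in>{..<n}. U p + c p)" for U
  define X where "X p = {U \<in> cube. U p + c p \<notin> {0..<int M}}" for p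
  have fin: "finite cube" by (auto simp: cube_def intro!: finite_PiE)
  have inj: "inj_on \<sigma> cube"
  proof (rule inj_onI)
    fix U V assume UV: "U \<in> cube" "V \<in> cube" "\<sigma> U = \<sigma> V"
    show "U = V"
    proof (rule PiE_ext[OF UV(1,2)[unfolded cube_def]])
      fix p assume "p \<in> {..<n}"
      with fun_cong[OF UV(3), of p] show "U p = V p" by (simp add: \<sigma>_def)
    qed
  qed
  have card_X: "real (card (X p)) \<le> real K / M * M ^ n" if "p < n" for p
  proof -
    define Y where "Y q = {u \<in> {0..<int M}. q = p \<longrightarrow> u + c p \<notin> {0..<int M}}" for q
    have Y_other: "Y q = {0..<int M}" if "q \<noteq> p" for q using that by (auto simp: Y_def)
    have "U \<in> X p \<longleftrightarrow> U \<in> PiE {..<n} Y" for U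
      using that unfolding X_def cube_def Y_def PiE_iff by blast
    then have "X p = PiE {..<n} Y" by blast
    then have "card (X p) = (\<Prod>q<n. card (Y q))" by (simp add: card_PiE)
    also have "\<dots> = card (Y p) * (\<Prod>q\<in>{..<n} - {p}. card (Y q))"
      using that by (subst prod.remove[of _ p]) auto
    also have "(\<Prod>q\<in>{..<n} - {p}. card (Y q)) = M ^ (n - 1)"
      using that by (simp add: Y_other)
    also have "card (Y p) * M ^ (n - 1) \<le> K * M ^ (n - 1)"
      using card_shift_out[OF c[of p], of M] by (simp add: Y_def)
    finally have "real (card (X p)) \<le> real (K * M ^ (n - 1))" by (rule of_nat_mono)
    also have "M ^ n = M ^ (n - 1) * M" using that by (cases n) auto
    then have "real (K * M ^ (n - 1)) = real K / M * M ^ n" using \<open>M > 0\<close> by simp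
    finally show ?thesis .
  qed
  have "(\<Sum>U\<in>cube. g (\<sigma> U)) = (\<Sum>U\<in>{U \<in> cube. \<sigma> U \<in> cube}. g (\<sigma> U)) + (\<Sum>U\<in>{U \<in> cube. \<sigma> U \<notin> cube}. g (\<sigma> U))"
    using fin by (subst sum.union_disjoint[symmetric]) (auto intro!: sum.cong)
  also have "(\<Sum>U\<in>{U \<in> cube. \<sigma> U \<in> cube}. g (\<sigma> U)) = sum g (\<sigma> ` {U \<in> cube. \<sigma> U \<in> cube})"
    by (subst sum.reindex) (auto intro: inj_on_subset[OF inj])
  also have "\<dots> \<le> sum g cube" by (rule sum_mono2[OF fin]) (use g in auto)
  also have "(\<Sum>U\<in>{U \<in> cube. \<sigma> U \<notin> cube}. g (\<sigma> U)) \<le> real (card {U \<in> cube. \<sigma> U \<notin> cube})"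
    using sum_bounded_above[of "{U \<in> cube. \<sigma> U \<notin> cube}" "\<lambda>U. g (\<sigma> U)" 1] g by simp
  also have "\<dots> \<le> real (\<Sum>p<n. card (X p))"
  proof (rule of_nat_mono)
    have "{U \<in> cube. \<sigma> U \<notin> cube} \<subseteq> (\<Union>p<n. X p)"
      by (auto simp: X_def cube_def \<sigma>_def PiE_iff)
    then have "card {U \<in> cube. \<sigma> U \<notin> cube} \<le> card (\<Union>p<n. X p)"
      by (rule card_mono[rotated]) (use fin in \<open>auto simp: X_def\<close>)
    also have "\<dots> \<le> (\<Sum>p<n. card (X p))" by (rule card_UN_le) simp
    finally show "card {U \<in> cube. \<sigma> U \<notin> cube} \<le> (\<Sum>p<n. card (X p))" .
  qed
  also have "\<dots> \<le> (\<Sum>p<n. real K / M * M ^ n)"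
    unfolding of_nat_sum by (intro sum_mono card_X) simp
  also have "\<dots> = real n * K / M * M ^ n" by simp
  finally show ?thesis unfolding \<sigma>_def by linarith
qed

text \<open>The averaging in Yao's principle: an inequality for every deterministic algorithm is
  integrated over the random choice of the algorithm.\<close>

lemma (in prob_space) sum_prob_le:
  assumes "finite I" "\<And>i. i \<in> I \<Longrightarrow> E i \<in> events" "\<And>i. i \<in> I \<Longrightarrow> E' i \<in> events"
    "\<And>x. x \<in> space M \<Longrightarrow> (\<Sum>i\<in>I. indicator (E i) x) \<le> (\<Sum>i\<in>I. indicator (E' i) x) + (K :: real)"
  shows "(\<Sum>i\<in>I. prob (E i)) \<le> (\<Sum>i\<in>I. prob (E' i)) + K"
proof -
  have int: "integrable M (indicator (E i) :: _ \<Rightarrow> real)" "integrable M (indicator (E' i) :: _ \<Rightarrow> real)"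
    if "i \<in> I" for i
    using assms that by (auto simp: emeasure_eq_measure intro!: integrable_real_indicator)
  have "(\<Sum>i\<in>I. prob (E i)) = (\<integral>x. (\<Sum>i\<in>I. indicator (E i) x) \<partial>M)"
    using assms int by (subst Bochner_Integration.integral_sum) (auto intro!: sum.cong)
  also have "\<dots> \<le> (\<integral>x. (\<Sum>i\<in>I. indicator (E' i) x) + K \<partial>M)"
    by (rule integral_mono) (use assms int in auto)
  also have "\<dots> = (\<Sum>i\<in>I. prob (E' i)) + K"
    using assms int
    by (subst Bochner_Integration.integral_add) (auto simp: prob_space intro!: sum.cong)
  finally show ?thesis .
qed

context quaternary_base
begin

lemma branches_cong:
  assumes "x \<in> Q" "y \<in> Q" "node (Suc k) x = node (Suc k) y" "branches Q k x"
  shows "branches Q k y"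
  using assms unfolding branches_def by metis

text \<open>
  Where the bottom labels of the two arrays differ, the queries see a single child of the node,
  so that a shift of the offset of the node makes up for the difference.
\<close>

lemma unseen_same_view:
  assumes "\<not> seen Q is k" "sorted_wrt (>) (is @ [k])"
  obtains F where "F \<subseteq> (\<lambda>(i, x). (i, node (Suc i) x)) ` (set is \<times> Q)"
    "\<And>\<rho>. \<exists>c. (\<forall>p. \<bar>c p\<bar> \<le> int B) \<and>
       (\<forall>U U'. \<forall>x\<in>Q. U' (node (Suc k) x) = U (node (Suc k) x) + c (node (Suc k) x) \<longrightarrow>
          entry L M is k (label \<rho> True is) U x = entry L M is k (label (sym_diff \<rho> F) False is) U' x)"
proof -
  from flip_shares[OF assms] obtain F where
    F: "F \<subseteq> (\<lambda>(i, x). (i, node (Suc i) x)) ` (set is \<times> Q)" and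
    flip: "\<And>\<rho> s x. x \<in> Q \<Longrightarrow> branches Q k x \<Longrightarrow> label (sym_diff \<rho> F) (\<not> s) is x = label \<rho> s is x"
    by blast
  have "\<exists>c. (\<forall>p. \<bar>c p\<bar> \<le> int B) \<and>
       (\<forall>U U'. \<forall>x\<in>Q. U' (node (Suc k) x) = U (node (Suc k) x) + c (node (Suc k) x) \<longrightarrow>
          entry L M is k (label \<rho> True is) U x = entry L M is k (label (sym_diff \<rho> F) False is) U' x)"
    for \<rho>
  proof -
    define f where "f = label \<rho> True is"
    define f' where "f' = label (sym_diff \<rho> F) False is"
    define e where "e h x = (if h x then int (dig k x) else int (B - 1 - dig k x))" for h :: "nat \<Rightarrow> bool" and x
    \<comment> \<open>The offset absorbs the difference of the bottom digits at an arbitrary query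
      of the node; by \<open>same\<close>, all queries of the node have this difference. The shift
      may depend on \<open>\<rho>\<close>, whereas \<open>F\<close> is fixed beforehand.\<close>
    define c where "c p = (if \<exists>x\<in>Q. node (Suc k) x = p
        then e f (SOME x. x \<in> Q \<and> node (Suc k) x = p) - e f' (SOME x. x \<in> Q \<and> node (Suc k) x = p) else 0)" for p
    have e_range: "0 \<le> e h x \<and> e h x < int B" for h x
      using dig_less[of k x] by (auto simp: e_def)
    have "\<bar>e f x - e f' x\<bar> \<le> int B" for x
      using e_range[of f x] e_range[of f' x] by linarith
    then have "\<bar>c p\<bar> \<le> int B" for p by (simp add: c_def)
    moreover have ki: "k < i" if "i \<in> set is" for i using that assms(2) by (auto simp: sorted_wrt_append)
    have same: "e f x - e f' x = e f y - e f' y"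
      if "x \<in> Q" "y \<in> Q" "node (Suc k) x = node (Suc k) y" for x y
    proof (cases "branches Q k x")
      case True
      then have "branches Q k y" by (rule branches_cong[OF that])
      with True flip[of x \<rho> True] flip[of y \<rho> True] that(1,2) have "f' x = f x" "f' y = f y"
        by (simp_all add: f_def f'_def)
      then show ?thesis by (simp add: e_def)
    next
      case False
      have "node k x = node k y"
      proof (rule ccontr)
        assume "node k x \<noteq> node k y"
        with that have "branches Q k x" unfolding branches_def by (intro bexI[of _ y]) auto
        with False show False by simp
      qed
      moreover have "label r s is x = label r s is y" for r s
        by (rule label_cong, rule node_eq_mono[OF that(3)]) (use ki in \<open>simp add: Suc_leI\<close>)
      ultimately show ?thesis by (simp add: e_def f_def f'_def dig_def)
    qed
    have "entry L M is k f U x = entry L M is k f' U' x"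
      if x: "x \<in> Q" and U': "U' (node (Suc k) x) = U (node (Suc k) x) + c (node (Suc k) x)" for U U' x
    proof -
      define y where "y = (SOME y. y \<in> Q \<and> node (Suc k) y = node (Suc k) x)"
      have "y \<in> Q \<and> node (Suc k) y = node (Suc k) x"
        unfolding y_def by (rule someI[of _ x]) (use x in simp)
      then have "e f y - e f' y = e f x - e f' x" by (intro same x) auto
      moreover have "c (node (Suc k) x) = e f y - e f' y"
        using x unfolding c_def y_def by auto
      ultimately have "U (node (Suc k) x) + e f x = U' (node (Suc k) x) + e f' x"
        using U' by simp
      then have "out_digit is k f U i x = out_digit is k f' U' i x" for i
        by (simp add: out_digit_def e_def)
      then show ?thesis unfolding entry_def by (intro assemble_cong) auto
    qed
    ultimately show ?thesis unfolding f_def f'_def by blast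
  qed
  with F that show ?thesis by blast
qed

text \<open>By \<open>node i x \<le> x\<close>, indices below \<open>n\<close> are enough to address
  all nodes above the positions \<open>{..<n}\<close>.\<close>

definition shares :: "nat \<Rightarrow> nat \<Rightarrow> (nat \<times> nat) set set" where
  "shares L n = Pow ({..<L} \<times> {..<n})"

definition offsets :: "nat \<Rightarrow> nat \<Rightarrow> (nat \<Rightarrow> int) set" where
  "offsets M n = {..<n} \<rightarrow>\<^sub>E {0..<int M}"

lemma finite_shares: "finite (shares L n)"
  by (simp add: shares_def)

lemma finite_offsets: "finite (offsets M n)" and card_offsets: "card (offsets M n) = M ^ n"
  by (auto simp: offsets_def card_PiE intro!: finite_PiE)

lemma node_le: "node i x \<le> x"
  by (simp add: node_def)

lemma offset_ok_offsets: "U \<in> offsets M n \<Longrightarrow> x < n \<Longrightarrow> offset_ok M k U x"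
  using node_le[of "Suc k" x] by (auto simp: offset_ok_def offsets_def PiE_iff)

text \<open>The shares \<open>\<rho>\<close> with secret 1 are matched with
  \<open>sym_diff \<rho> F\<close> with secret 0, a bijection because \<open>F\<close> does not
  depend on \<open>\<rho>\<close>. For each \<open>\<rho>\<close> the offsets undergo a fixed shift,
  at the cost of a fraction \<open>n * B / M\<close>.\<close>

lemma sum_accept_unseen:
  assumes "\<not> seen Q is k" "sorted_wrt (>) (is @ [k])" "set is \<subseteq> {..<L}" "Q \<subseteq> {..<n}" "M > 0"
    "\<And>A A'. (\<And>x. x \<in> Q \<Longrightarrow> A (Suc x) = A' (Suc x)) \<Longrightarrow> acc A = acc A'"
  shows "(\<Sum>\<rho>\<in>shares L n. \<Sum>U\<in>offsets M n. of_bool (acc (array L M is k True \<rho> U)))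
     \<le> (\<Sum>\<rho>\<in>shares L n. \<Sum>U\<in>offsets M n. of_bool (acc (array L M is k False \<rho> U)))
        + real n * B / M * card (shares L n) * M ^ n"
proof -
  from unseen_same_view[OF assms(1,2), of L M] obtain F where
    F: "F \<subseteq> (\<lambda>(i, x). (i, node (Suc i) x)) ` (set is \<times> Q)" and
    view: "\<And>\<rho>. \<exists>c. (\<forall>p. \<bar>c p\<bar> \<le> int B) \<and>
       (\<forall>U U'. \<forall>x\<in>Q. U' (node (Suc k) x) = U (node (Suc k) x) + c (node (Suc k) x) \<longrightarrow>
          entry L M is k (label \<rho> True is) U x = entry L M is k (label (sym_diff \<rho> F) False is) U' x)"
    by blast
  define g where "g \<rho> U = (of_bool (acc (array L M is k False \<rho> U)) :: real)" for \<rho> U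
  have FX: "F \<subseteq> {..<L} \<times> {..<n}"
  proof
    fix z assume "z \<in> F"
    with F obtain i x where "z = (i, node (Suc i) x)" "i \<in> set is" "x \<in> Q" by auto
    with assms(3,4) node_le[of "Suc i" x] show "z \<in> {..<L} \<times> {..<n}" by auto
  qed
  have bij: "bij_betw (\<lambda>\<rho>. sym_diff \<rho> F) (shares L n) (shares L n)"
    by (rule bij_betwI[where g = "\<lambda>\<rho>. sym_diff \<rho> F"]) (use FX in \<open>auto simp: shares_def\<close>)
  have "(\<Sum>U\<in>offsets M n. of_bool (acc (array L M is k True \<rho> U)))
      \<le> (\<Sum>U\<in>offsets M n. g (sym_diff \<rho> F) U) + real n * B / M * M ^ n" for \<rho>
  proof -
    from view[of \<rho>] obtain c where c: "\<And>p. \<bar>c p\<bar> \<le> int B" and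
      eq: "\<And>U U' x. x \<in> Q \<Longrightarrow> U' (node (Suc k) x) = U (node (Suc k) x) + c (node (Suc k) x) \<Longrightarrow>
        entry L M is k (label \<rho> True is) U x = entry L M is k (label (sym_diff \<rho> F) False is) U' x"
      by blast
    have "acc (array L M is k True \<rho> U) =
        acc (array L M is k False (sym_diff \<rho> F) (\<lambda>p\<in>{..<n}. U p + c p))" for U
    proof (rule assms(6))
      fix x assume x: "x \<in> Q"
      have "node (Suc k) x < n" using x assms(4) node_le[of "Suc k" x] by auto
      then show "array L M is k True \<rho> U (Suc x) =
          array L M is k False (sym_diff \<rho> F) (\<lambda>p\<in>{..<n}. U p + c p) (Suc x)"
        using eq[OF x, of "\<lambda>p\<in>{..<n}. U p + c p" U] by (simp add: array_def)
    qed
    then have "(\<Sum>U\<in>offsets M n. of_bool (acc (array L M is k True \<rho> U))) =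
        (\<Sum>U\<in>offsets M n. g (sym_diff \<rho> F) (\<lambda>p\<in>{..<n}. U p + c p))"
      by (simp add: g_def)
    also have "\<dots> \<le> (\<Sum>U\<in>offsets M n. g (sym_diff \<rho> F) U) + real n * B / M * M ^ n"
      unfolding offsets_def by (rule sum_shift_le) (use c assms(5) in \<open>auto simp: g_def\<close>)
    finally show ?thesis .
  qed
  then have "(\<Sum>\<rho>\<in>shares L n. \<Sum>U\<in>offsets M n. of_bool (acc (array L M is k True \<rho> U)))
     \<le> (\<Sum>\<rho>\<in>shares L n. (\<Sum>U\<in>offsets M n. g (sym_diff \<rho> F) U) + real n * B / M * M ^ n)"
    by (intro sum_mono)
  also have "\<dots> = (\<Sum>\<rho>\<in>shares L n. \<Sum>U\<in>offsets M n. g (sym_diff \<rho> F) U)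
      + real n * B / M * card (shares L n) * M ^ n"
    by (simp add: sum.distrib)
  also have "(\<Sum>\<rho>\<in>shares L n. \<Sum>U\<in>offsets M n. g (sym_diff \<rho> F) U)
      = (\<Sum>\<rho>\<in>shares L n. \<Sum>U\<in>offsets M n. g \<rho> U)"
    by (rule sum.reindex_bij_betw[OF bij])
  finally show ?thesis unfolding g_def .
qed

section \<open>Averaging over the choices of levels\<close>

definition level_choices :: "nat \<Rightarrow> nat \<Rightarrow> (nat list \<times> nat) set" where
  "level_choices m t = upper_levels m t \<times> {..<m}"

lemma level_choicesD:
  assumes "(is, k) \<in> level_choices m t"
  shows "set is \<subseteq> {..<Suc t * m}" "sorted_wrt (>) (is @ [k])" "k < Suc t * m" "length is = t"
proof -
  have "is": "is \<in> upper_levels m t" and k: "k < m" using assms by (auto simp: level_choices_def)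
  show "set is \<subseteq> {..<Suc t * m}" using upper_levels_bounds[OF "is"] by auto
  have "k < i" if "i \<in> set is" for i using upper_levels_bounds[OF "is" that] k by linarith
  then show "sorted_wrt (>) (is @ [k])"
    using sorted_upper_levels[OF "is"] by (simp add: sorted_wrt_append)
  show "k < Suc t * m" using k by (simp add: trans_less_add1)
  show "length is = t" by (rule length_upper_levels[OF "is"])
qed

text \<open>Recognised choices of levels are bounded trivially and make up at most 1/12 of all
  choices; every other choice loses at most 1/12 to the shift of the offsets. Together this is
  1/6.\<close>

lemma sum_accept_le:
  assumes "finite Q" "card Q \<le> q" "q \<le> 2 ^ l" "Q \<subseteq> {..<n}" "M > 0" "12 * n * B \<le> M"
    "12 * (q * l ^ Suc t) \<le> m ^ Suc t"
    "\<And>A A'. (\<And>x. x \<in> Q \<Longrightarrow> A (Suc x) = A' (Suc x)) \<Longrightarrow> acc A = acc A'"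
  defines "L \<equiv> Suc t * m"
  shows "(\<Sum>(is, k)\<in>level_choices m t. \<Sum>\<rho>\<in>shares L n. \<Sum>U\<in>offsets M n. of_bool (acc (array L M is k True \<rho> U)))
     \<le> (\<Sum>(is, k)\<in>level_choices m t. \<Sum>\<rho>\<in>shares L n. \<Sum>U\<in>offsets M n. of_bool (acc (array L M is k False \<rho> U)))
        + real (card (level_choices m t) * (card (shares L n) * card (offsets M n))) / 6"
proof -
  define W where "W = real (card (shares L n) * card (offsets M n))"
  define a where "a s = (\<lambda>(is, k). \<Sum>\<rho>\<in>shares L n. \<Sum>U\<in>offsets M n. of_bool (acc (array L M is k s \<rho> U)) :: real)" for s
  define bad where "bad = seen_levels m Q t"
  have fin: "finite (level_choices m t)" by (simp add: level_choices_def finite_upper_levels)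
  have bad: "bad \<subseteq> level_choices m t" by (auto simp: bad_def seen_levels_def level_choices_def)
  have W0: "0 \<le> W" by (simp add: W_def)
  have "a True z \<le> a False z + (W / 12 + (if z \<in> bad then W else 0))" if z: "z \<in> level_choices m t" for z
  proof (cases z)
    case (Pair "is" k)
    show ?thesis
    proof (cases "z \<in> bad")
      case True
      have "a True z \<le> (\<Sum>\<rho>\<in>shares L n. \<Sum>U\<in>offsets M n. 1)"
        unfolding a_def Pair prod.case by (intro sum_mono) auto
      also have "\<dots> = W" by (simp add: W_def)
      finally have "a True z \<le> W" .
      moreover have "0 \<le> a False z" unfolding a_def Pair prod.case by (intro sum_nonneg) auto
      ultimately show ?thesis using True W0 by simp
    next
      case False
      then have unseen: "\<not> seen Q is k" using z by (auto simp: bad_def Pair seen_levels_def level_choices_def)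
      note levels = level_choicesD[OF z[unfolded Pair], folded L_def]
      have "a True z \<le> a False z + real n * B / M * card (shares L n) * M ^ n"
        unfolding a_def Pair prod.case
        by (rule sum_accept_unseen[OF unseen levels(2,1) assms(4,5,8)])
      also have "real n * B / M * card (shares L n) * M ^ n = real (n * B) / M * W"
        by (simp add: W_def card_offsets)
      also have "\<dots> \<le> 1 / 12 * W"
      proof (rule mult_right_mono[OF _ W0])
        have "real (12 * n * B) \<le> real M" using assms(6) by (rule of_nat_mono)
        then show "real (n * B) / M \<le> 1 / 12" using \<open>M > 0\<close> by (simp add: field_simps)
      qed
      finally show ?thesis using False by simp
    qed
  qed
  then have "sum (a True) (level_choices m t) \<le>
      (\<Sum>z\<in>level_choices m t. a False z + (W / 12 + (if z \<in> bad then W else 0)))" by (rule sum_mono)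
  also have "\<dots> = sum (a False) (level_choices m t) + (card (level_choices m t) * (W / 12) + card bad * W)"
    using fin bad by (simp add: sum.distrib sum.If_cases Int_absorb1)
  also have "real (card bad) * W \<le> real (card (level_choices m t)) / 12 * W"
  proof (rule mult_right_mono[OF _ W0])
    have "card bad \<le> card Q * l ^ Suc t"
      unfolding bad_def by (rule card_seen_levels_le) (use assms in auto)
    also have "\<dots> \<le> q * l ^ Suc t" by (rule mult_right_mono) (use assms in auto)
    finally have "12 * card bad \<le> m ^ Suc t" using assms(7) by linarith
    moreover have "card (level_choices m t) = m ^ Suc t"
      by (simp add: level_choices_def card_cartesian_product card_upper_levels mult.commute)
    ultimately have "real (12 * card bad) \<le> real (card (level_choices m t))" by (simp only: of_nat_le_iff)
    then show "real (card bad) \<le> real (card (level_choices m t)) / 12" by simp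
  qed
  finally show ?thesis by (simp add: a_def W_def case_prod_unfold mult_ac)
qed

text \<open>On average the tester would accept with probability at least 2/3 for secret 1 and at
  most 1/3 for secret 0, but the former average exceeds the latter by at most 1/6.\<close>

lemma no_tester:
  assumes tester: "nonadaptive_tolerant_tester n \<delta>1 \<delta>2 T"
    and queries: "\<And>D. D \<in> space T \<Longrightarrow> length (queries D) \<le> q"
    and q: "q \<le> 2 ^ l" "12 * (q * l ^ Suc t) \<le> m ^ Suc t"
    and "m > 0"
    and close: "real n - (real n - B ^ (Suc t * m)) / 2 ^ t < \<delta>1 * n"
    and far: "\<delta>2 * n \<le> real n - (real n + B ^ (Suc t * m)) * lis_frac t False"
  shows False
proof -
  define L where "L = Suc t * m"
  \<comment> \<open>Large enough for \<open>n * B / M \<le> 1 / 12\<close>; the summand 1 keeps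
    \<open>M\<close> positive when \<open>n = 0\<close>.\<close>
  define M where "M = 12 * n * B + 1"
  define I where "I = level_choices m t \<times> (shares L n \<times> offsets M n)"
  define A where "A s = (\<lambda>((is, k), (\<rho>, U)). array L M is k s \<rho> U)" for s
  define E where "E s z = {D \<in> space T. accepts D (A s z)}" for s z
  define N where "N = real (card (level_choices m t) * (card (shares L n) * card (offsets M n)))"
  have alg: "prob_space T" "\<And>D. D \<in> space T \<Longrightarrow> set (queries D) \<subseteq> {1..n}"
    "\<And>A. {D \<in> space T. accepts D A} \<in> sets T"
    using tester by (auto simp: nonadaptive_tolerant_tester_def nonadaptive_randomized_alg_def)
  interpret T: prob_space T by (rule alg(1))
  have fin: "finite I"
    by (simp add: I_def finite_shares finite_offsets level_choices_def finite_upper_levels)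
  have card_I: "real (card I) = N" by (simp add: I_def N_def card_cartesian_product)
  have "N > 0"
    unfolding N_def of_nat_0_less_iff using \<open>m > 0\<close>
    by (simp add: level_choices_def card_cartesian_product card_upper_levels
        card_offsets shares_def card_Pow M_def)
  have "(\<Sum>z\<in>I. T.prob (E True z)) \<le> (\<Sum>z\<in>I. T.prob (E False z)) + N / 6"
  proof (rule T.sum_prob_le[OF fin])
    fix D assume D: "D \<in> space T"
    define Q where "Q = (\<lambda>i. i - 1) ` set (queries D)"
    have sum: "(\<Sum>z\<in>I. indicator (E s z) D) = (\<Sum>(is, k)\<in>level_choices m t. \<Sum>\<rho>\<in>shares L n.
        \<Sum>U\<in>offsets M n. of_bool (accepts D (array L M is k s \<rho> U)) :: real)" for s
      using D unfolding I_def sum.cartesian_product'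
      by (simp add: E_def A_def indicator_def case_prod_unfold)
    show "(\<Sum>z\<in>I. indicator (E True z) D) \<le> (\<Sum>z\<in>I. indicator (E False z) D) + N / 6"
      unfolding sum N_def L_def
    proof (rule sum_accept_le)
      show "card Q \<le> q"
        using card_image_le[of "set (queries D)" "\<lambda>i. i - 1"] card_length[of "queries D"] queries[OF D]
        by (simp add: Q_def)
      show "Q \<subseteq> {..<n}" using alg(2)[OF D] by (fastforce simp: Q_def)
      fix A A' :: "nat \<Rightarrow> real" assume eq: "\<And>x. x \<in> Q \<Longrightarrow> A (Suc x) = A' (Suc x)"
      have "map A (queries D) = map A' (queries D)"
      proof (rule map_cong[OF refl])
        fix i assume i: "i \<in> set (queries D)"
        then have "1 \<le> i" using alg(2)[OF D] by auto
        with eq[of "i - 1"] i show "A i = A' i" by (simp add: Q_def)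
      qed
      then show "accepts D A = accepts D A'" by (simp only: accepts_def)
    qed (use q in \<open>simp_all add: Q_def M_def\<close>)
  qed (use alg(3) in \<open>auto simp: E_def\<close>)
  moreover have "2 / 3 \<le> T.prob (E True z)" if "z \<in> I" for z
  proof -
    from that obtain "is" k \<rho> U where z: "z = ((is, k), (\<rho>, U))" "(is, k) \<in> level_choices m t"
      "U \<in> offsets M n" by (auto simp: I_def)
    note levels = level_choicesD[OF z(2), folded L_def]
    have "real (dist_to_mono n (A True z)) \<le> real n - (real n - B ^ L) / 2 ^ t"
      using dist_array_True_le[OF levels(1,2) offset_ok_offsets[OF z(3)], where \<rho> = \<rho>]
      by (simp add: A_def z(1) levels(4))
    also have "\<dots> < \<delta>1 * n" using close by (simp add: L_def)
    finally show ?thesis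
      using tester by (auto simp: nonadaptive_tolerant_tester_def E_def)
  qed
  then have "(\<Sum>z\<in>I. 2 / 3) \<le> (\<Sum>z\<in>I. T.prob (E True z))" by (rule sum_mono)
  moreover have "T.prob (E False z) \<le> 1 / 3" if "z \<in> I" for z
  proof -
    from that obtain "is" k \<rho> U where z: "z = ((is, k), (\<rho>, U))" "(is, k) \<in> level_choices m t"
      "U \<in> offsets M n" by (auto simp: I_def)
    note levels = level_choicesD[OF z(2), folded L_def]
    have "\<delta>2 * n \<le> real n - (real n + B ^ L) * lis_frac t False" using far by (simp add: L_def)
    also have "\<dots> \<le> real (dist_to_mono n (A False z))"
      using dist_array_False_ge[OF levels(1,2) offset_ok_offsets[OF z(3)] levels(3), where \<rho> = \<rho>]
      by (simp add: A_def z(1) levels(4))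
    finally have "2 / 3 \<le> T.prob {D \<in> space T. \<not> accepts D (A False z)}"
      using tester by (auto simp: nonadaptive_tolerant_tester_def)
    also have "{D \<in> space T. \<not> accepts D (A False z)} = space T - E False z" by (auto simp: E_def)
    also have "T.prob \<dots> = 1 - T.prob (E False z)"
      by (rule T.prob_compl) (simp add: E_def alg(3))
    finally show ?thesis by simp
  qed
  then have "(\<Sum>z\<in>I. T.prob (E False z)) \<le> (\<Sum>z\<in>I. 1 / 3)" by (rule sum_mono)
  ultimately show False using \<open>N > 0\<close> card_I by simp
qed

section \<open>Choice of the parameters for large arrays\<close>

lemma eventually_lower_bound:
  fixes t :: nat and \<epsilon> \<eta> :: real
  assumes "0 < \<epsilon>" "0 < \<eta>" and gap: "4 * \<eta> = (1 - 1 / B) / 4 ^ t - \<epsilon>"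
  defines "h \<equiv> Suc t" and "\<delta> \<equiv> 1 - 1 / 2 ^ t + \<eta>"
  shows "\<forall>\<^sub>F n in sequentially. \<forall>T. nonadaptive_tolerant_tester n \<delta> (\<delta> + \<epsilon>) T \<longrightarrow>
    ereal (ln (real n) powr (real h / 2)) \<le> query_complexity T"
proof -
  \<comment> \<open>With \<open>m \<le> \<kappa> * ln n\<close> the nodes of height
    \<open>h * m\<close> have size \<open>B ^ (h * m) \<le> sqrt n\<close>, so incomplete nodes are
    negligible.\<close>
  define \<kappa> where "\<kappa> = 1 / (2 * real h * ln B)"
  have lnB: "ln B > 0" using B_gt_1 by simp
  then have \<kappa>: "\<kappa> > 0" by (simp add: \<kappa>_def h_def)
  have h: "real h > 0" by (simp add: h_def)
  \<comment> \<open>With \<open>y = ln n\<close>, this is the \<open>h\<close>-th root of the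
    condition on \<open>q\<close>, \<open>l\<close> and \<open>m\<close>: \<open>sqrt y\<close>
    stands for the root of \<open>q\<close>, \<open>real h * ln y + 1\<close> bounds
    \<open>l\<close>, and the right-hand side is a lower bound for \<open>m\<close>.\<close>
  have "\<forall>\<^sub>F y in at_top. 12 * (sqrt y * (real h * ln y + 1)) \<le> \<kappa> * y - 1"
    using \<kappa> h by real_asymp
  moreover have "\<forall>\<^sub>F y in at_top. 1 \<le> \<kappa> * y - 1"
    using \<kappa> by real_asymp
  moreover have "\<forall>\<^sub>F y::real in at_top. 1 \<le> y" by (rule eventually_ge_at_top)
  ultimately have "\<forall>\<^sub>F y in at_top.
      12 * (sqrt y * (real h * ln y + 1)) \<le> \<kappa> * y - 1 \<and> 1 \<le> \<kappa> * y - 1 \<and> 1 \<le> y"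
    by eventually_elim blast
  moreover have "filterlim (\<lambda>n::nat. ln (real n)) at_top sequentially" by real_asymp
  ultimately have "\<forall>\<^sub>F n in sequentially.
      12 * (sqrt (ln (real n)) * (real h * ln (ln (real n)) + 1)) \<le> \<kappa> * ln (real n) - 1 \<and>
      1 \<le> \<kappa> * ln (real n) - 1 \<and> 1 \<le> ln (real n)"
    by (rule eventually_compose_filterlim)
  moreover have "\<forall>\<^sub>F n in sequentially. sqrt (real n) < \<eta> * real n"
    using \<open>0 < \<eta>\<close> by real_asymp
  ultimately show ?thesis
  proof eventually_elim
    case (elim n)
    define y where "y = ln (real n)"
    have y: "12 * (sqrt y * (real h * ln y + 1)) \<le> \<kappa> * y - 1" "1 \<le> \<kappa> * y - 1" "1 \<le> y"
      using elim by (simp_all add: y_def)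
    define m where "m = nat \<lfloor>\<kappa> * y\<rfloor>"
    define q where "q = nat \<lfloor>y powr (real h / 2)\<rfloor>"
    define l where "l = nat \<lceil>real h * ln y\<rceil>"
    have n: "0 < real n" using y(3) by (cases n) (auto simp: y_def)
    have m: "\<kappa> * y - 1 \<le> real m" "real m \<le> \<kappa> * y" "m > 0" using y(2) unfolding m_def by linarith+
    have "0 \<le> real h * ln y" using h y(3) by simp
    then have l: "real h * ln y \<le> real l" "real l \<le> real h * ln y + 1" unfolding l_def by linarith+
    have powr_eq: "y powr (real h / 2) = sqrt y ^ h"
      using y(3) by (simp add: powr_half_sqrt[symmetric] powr_powr flip: powr_realpow)
    have q: "real q \<le> sqrt y ^ h" using y(3) by (simp add: q_def powr_eq[symmetric])
    have "q \<le> 2 ^ l"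
    proof -
      \<comment> \<open>The crude bound on \<open>ln 2\<close> suffices because \<open>l\<close> is
        at least \<open>h * ln y\<close>, twice the logarithm of
        \<open>y powr (h / 2)\<close>.\<close>
      have "1 / 2 \<le> ln (2::real)" using ln2_ge_two_thirds by simp
      then have "1 / 2 * (real h * ln y) \<le> ln 2 * real l"
        using l \<open>0 \<le> real h * ln y\<close> by (intro mult_mono) auto
      then have "exp (1 / 2 * (real h * ln y)) \<le> exp (ln 2 * real l)" by simp
      also have "\<dots> = 2 ^ l" by (simp add: exp_of_nat2_mult)
      also have "exp (1 / 2 * (real h * ln y)) = y powr (real h / 2)" using y(3) by (simp add: powr_def)
      finally have "sqrt y ^ h \<le> real (2 ^ l)" using powr_eq by simp
      with q have "real q \<le> real (2 ^ l)" by (rule order_trans)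
      then show ?thesis by (simp only: of_nat_le_iff)
    qed
    have "12 * (q * l ^ h) \<le> m ^ h"
    proof -
      have "real (q * l ^ h) \<le> sqrt y ^ h * (real h * ln y + 1) ^ h"
        unfolding of_nat_mult of_nat_power using q l y(3) by (intro mult_mono power_mono) auto
      then have "12 * real (q * l ^ h) \<le> 12 ^ h * (sqrt y ^ h * (real h * ln y + 1) ^ h)"
        using power_increasing[of 1 h "12::real"] by (intro mult_mono) (auto simp: h_def)
      also have "\<dots> = (12 * (sqrt y * (real h * ln y + 1))) ^ h" by (simp add: power_mult_distrib)
      also have "\<dots> \<le> real m ^ h"
        using y m(1) \<open>0 \<le> real h * ln y\<close> by (intro power_mono) auto
      finally have "real (12 * (q * l ^ h)) \<le> real (m ^ h)" by simp
      then show ?thesis by (simp only: of_nat_le_iff)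
    qed
    have small: "real (B ^ (h * m)) < \<eta> * n"
    proof -
      have "real (B ^ (h * m)) = exp (ln B * (real h * real m))"
        using B_pos by (simp add: exp_of_nat2_mult flip: of_nat_mult)
      also have "\<dots> \<le> exp (ln B * (real h * (\<kappa> * y)))"
        using lnB h m(2) by simp
      also have "ln B * (real h * (\<kappa> * y)) = y / 2" using lnB h by (simp add: \<kappa>_def)
      also have "exp (y / 2) = sqrt n"
        using n by (simp add: y_def powr_half_sqrt[symmetric] powr_def)
      finally show ?thesis using elim by simp
    qed
    \<comment> \<open>The choice of \<open>\<delta>\<close> leaves a margin of
      \<open>\<eta> * n\<close> on the close side and \<open>3 * \<eta> * n\<close> on the far side;
      both cover the error of at most \<open>N\<close> from incomplete nodes.\<close>
    define N where "N = real (B ^ (h * m))"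
    have N: "0 \<le> N" "N < \<eta> * n" using small by (simp_all add: N_def)
    have "N / 2 ^ t \<le> N" using N(1) by (simp add: divide_le_eq mult_le_cancel_left1)
    then have "real n - (real n - N) / 2 ^ t < \<delta> * n"
      using N by (simp add: \<delta>_def algebra_simps diff_divide_distrib)
    then have close: "real n - (real n - B ^ (Suc t * m)) / 2 ^ t < \<delta> * n"
      by (simp add: N_def h_def)
    have frac: "1 / 2 ^ t = lis_frac t False + 4 * \<eta> + \<epsilon>" using gap by (simp add: lis_frac_def)
    have "1 / (2::real) ^ t \<le> 1" by simp
    then have "lis_frac t False \<le> 1" using frac assms(1,2) by linarith
    then have "N * lis_frac t False \<le> N" using N(1) by (simp add: mult_left_le)
    moreover have "0 \<le> \<eta> * n" using n assms(2) by simp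
    ultimately have "N * lis_frac t False \<le> 3 * (\<eta> * n)" using N by linarith
    then have "(\<delta> + \<epsilon>) * n \<le> real n - (real n + N) * lis_frac t False"
      unfolding \<delta>_def frac by (simp add: algebra_simps)
    then have far: "(\<delta> + \<epsilon>) * n \<le> real n - (real n + B ^ (Suc t * m)) * lis_frac t False"
      by (simp add: N_def h_def)
    show ?case
    proof (intro allI impI)
      fix T assume T: "nonadaptive_tolerant_tester n \<delta> (\<delta> + \<epsilon>) T"
      show "ereal (ln (real n) powr (real h / 2)) \<le> query_complexity T"
      proof (rule ccontr)
        assume "\<not> ?thesis"
        then have less: "query_complexity T < ereal (y powr (real h / 2))" by (simp add: y_def)
        have "length (queries D) \<le> q" if "D \<in> space T" for D
        proof -
          have "ereal (real (length (queries D))) \<le> query_complexity T"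
            unfolding query_complexity_def by (rule SUP_upper[OF that])
          also note less
          finally show ?thesis unfolding q_def by (simp add: le_nat_floor)
        qed
        from no_tester[OF T this \<open>q \<le> 2 ^ l\<close> _ m(3) close far] \<open>12 * (q * l ^ h) \<le> m ^ h\<close>
        show False by (simp add: h_def)
      qed
    qed
  qed
qed

end

lemma power_bracket:
  fixes \<epsilon> :: real
  assumes "0 < \<epsilon>" "\<epsilon> < 1"
  obtains t :: nat where "\<epsilon> < 1 / 4 ^ t" "1 / 4 ^ Suc t \<le> \<epsilon>"
proof -
  define P where "P t \<longleftrightarrow> 1 / 4 ^ Suc t \<le> \<epsilon>" for t
  obtain N where "(1 / 4) ^ N < \<epsilon>"
    using real_arch_pow_inv[OF assms(1), of "1 / 4"] by auto
  then have "1 / 4 ^ Suc N \<le> \<epsilon>" by (simp add: power_one_over field_simps)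
  then have "P N" by (simp add: P_def)
  define t where "t = (LEAST t. P t)"
  have "P t" unfolding t_def by (rule LeastI[of P, OF \<open>P N\<close>])
  moreover have "\<epsilon> < 1 / 4 ^ t"
  proof (cases t)
    case (Suc s)
    then have "\<not> P s" unfolding t_def by (intro not_less_Least) simp
    with Suc show ?thesis by (simp add: P_def)
  qed (use assms in simp)
  ultimately show ?thesis using that by (simp add: P_def)
qed

theorem theorem1p6:
  "\<exists>c::real. c > 0 \<and>
     (\<forall>\<epsilon>::real. 0 < \<epsilon> \<and> \<epsilon> < 1 \<longrightarrow>
       (\<exists>\<delta>::real. 0 < \<delta> \<and> \<delta> < 1 \<and>
         (\<forall>\<^sub>F n::nat in sequentially.
           \<forall>T. nonadaptive_tolerant_tester n \<delta> (\<delta> + \<epsilon>) T \<longrightarrow>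
             ereal (ln (real n) powr (c * ln (1 / \<epsilon>))) \<le> query_complexity T)))"
proof (rule exI[of _ "1 / 4"], intro conjI allI impI)
  fix \<epsilon> :: real assume \<epsilon>: "0 < \<epsilon> \<and> \<epsilon> < 1"
  \<comment> \<open>The two densities differ by \<open>(1 - 1 / B) / 4 ^ t\<close>, so
    \<open>\<epsilon> < 1 / 4 ^ t\<close> leaves room for the gap, and the other inequality makes
    \<open>t\<close> grow like \<open>log (1 / \<epsilon>)\<close>.\<close>
  then obtain t where t: "\<epsilon> < 1 / 4 ^ t" "1 / 4 ^ Suc t \<le> \<epsilon>" by (metis power_bracket)
  have "0 < 1 - \<epsilon> * 4 ^ t" using t(1) by (simp add: field_simps)
  \<comment> \<open>The base is taken so large that the factor \<open>1 - 1 / B\<close> does not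
    bring the gap down to \<open>\<epsilon>\<close>.\<close>
  then obtain b where b: "inverse (real (Suc b)) < 1 - \<epsilon> * 4 ^ t" using reals_Archimedean by blast
  interpret quaternary_base "Suc b" by standard simp
  define G where "G = (1 - 1 / real B) / 4 ^ t"
  define \<eta> where "\<eta> = (G - \<epsilon>) / 4"
  define \<delta> where "\<delta> = 1 - 1 / 2 ^ t + \<eta>"
  have "1 / real B \<le> inverse (real (Suc b))" by (simp add: B_def field_simps)
  with b have "\<epsilon> * 4 ^ t < 1 - 1 / B" by simp
  then have \<eta>: "0 < \<eta>" by (simp add: \<eta>_def G_def field_simps)
  have "G \<le> 1 / 4 ^ t" unfolding G_def by (intro divide_right_mono) auto
  also have "\<dots> \<le> 1 / (2::real) ^ t" by (intro divide_left_mono power_mono) auto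
  finally have "G - \<epsilon> < 1 / 2 ^ t" using \<epsilon> by linarith
  moreover have gap: "4 * \<eta> = G - \<epsilon>" by (simp add: \<eta>_def)
  ultimately have "\<eta> < 1 / 2 ^ t" using \<eta> by linarith
  then have "\<delta> < 1" by (simp add: \<delta>_def)
  have "0 < \<delta>"
    using \<eta> by (smt (verit) \<delta>_def divide_le_eq_1 one_le_power)
  have "\<forall>\<^sub>F n in sequentially. \<forall>T. nonadaptive_tolerant_tester n \<delta> (\<delta> + \<epsilon>) T \<longrightarrow>
      ereal (ln (real n) powr (real (Suc t) / 2)) \<le> query_complexity T"
    unfolding \<delta>_def by (rule eventually_lower_bound) (use \<epsilon> \<eta> gap in \<open>simp_all add: G_def\<close>)
  moreover have "\<forall>\<^sub>F n::nat in sequentially. 1 \<le> ln (real n)"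
    by real_asymp
  then have "\<forall>\<^sub>F n::nat in sequentially. ln (real n) powr (1 / 4 * ln (1 / \<epsilon>)) \<le> ln (real n) powr (real (Suc t) / 2)"
  proof eventually_elim
    case (elim n)
    \<comment> \<open>The constant 1/4 comes from here:
      \<open>ln (1 / \<epsilon>) \<le> (t + 1) * ln 4 \<le> 2 * (t + 1)\<close>, and the exponent at
      hand is \<open>(t + 1) / 2\<close>.\<close>
    have "1 / \<epsilon> \<le> 4 ^ Suc t" using t(2) \<epsilon> by (simp add: field_simps)
    then have "ln (1 / \<epsilon>) \<le> ln (4 ^ Suc t)" using \<epsilon> by simp
    also have "\<dots> = real (Suc t) * ln 4" by (rule ln_realpow)
    also have "ln (4::real) = ln (2 ^ 2)" by simp
    also have "\<dots> = 2 * ln 2" by (subst ln_realpow) auto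
    also have "real (Suc t) * (2 * ln 2) \<le> real (Suc t) * 2"
      using ln_2_less_1 by (intro mult_left_mono) auto
    finally show ?case using elim by (intro powr_mono) auto
  qed
  ultimately have "\<forall>\<^sub>F n in sequentially. \<forall>T. nonadaptive_tolerant_tester n \<delta> (\<delta> + \<epsilon>) T \<longrightarrow>
      ereal (ln (real n) powr (1 / 4 * ln (1 / \<epsilon>))) \<le> query_complexity T"
    by eventually_elim (meson ereal_less_eq(3) order_trans)
  with \<open>0 < \<delta>\<close> \<open>\<delta> < 1\<close> show "\<exists>\<delta>::real. 0 < \<delta> \<and> \<delta> < 1 \<and>
         (\<forall>\<^sub>F n::nat in sequentially.
           \<forall>T. nonadaptive_tolerant_tester n \<delta> (\<delta> + \<epsilon>) T \<longrightarrow>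
             ereal (ln (real n) powr (1 / 4 * ln (1 / \<epsilon>))) \<le> query_complexity T)" by blast
qed simp

end
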